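(* Let $K$ be a unital commutative ring and let $A$ be an associative unital $K$-superalgebra which is free as a $K$-module with a $K$-basis containing the identity. If $\tau\colon\widetilde{\mathfrak{st}}(2,1,A)\to\mathfrak{st}(2,1,A)$ is a central extension of Lie superalgebras, then there exists a unique section $\eta\colon\mathfrak{st}(2,1,A)\to\widetilde{\mathfrak{st}}(2,1,A)$ of $\tau$, i.e. a unique Lie superalgebra homomorphism $\eta$ with $\tau\circ\eta=\mathrm{id}$.
   Context: $K$ is regarded as concentrated in even degree; $A=A_{\bar 0}\oplus A_{\bar 1}$ is $\mathbb{Z}/2$-graded and $|a|$ denotes the degree of a homogeneous element. Lie superalgebras: a Lie superalgebra over $K$ is a $\mathbb{Z}/2$-graded $K$-module $L$ with an even $K$-bilinear bracket such that $[x,y]=-(-1)^{|x||y|}[y,x]$, $[x_{\bar 0},x_{\bar 0}]=0$ for $x_{\bar 0}\in L_{\bar 0}$, and $(-1)^{|x||z|}[[x,y],z]+(-1)^{|x||y|}[[y,z],x]+(-1)^{|y||z|}[[z,x],y]=0$ for homogeneous $x,y,z$. Homomorphisms are even. A central extension of $L$ is a surjective Lie superalgebra homomorphism $M\to L$ whose kernel lies in the centre of $M$; here $\widetilde{\mathfrak{st}}(2,1,A)$ is just the name of the total Lie superalgebra of an arbitrary central extension. Steinberg Lie superalgebra $\mathfrak{st}(2,1,A)$: indices $1,2$ are even ($|1|=|2|=\bar 0$) and $3$ is odd ($|3|=\bar 1$). It is the Lie superalgebra over $K$ generated by homogeneous elements $F_{ij}(a)$, $1\le i\ne j\le 3$,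 $a\in A$ homogeneous, of degree $|F_{ij}(a)|=|i|+|j|+|a|$, subject to: $a\mapsto F_{ij}(a)$ is $K$-linear; $[F_{ij}(a),F_{jk}(b)]=F_{ik}(ab)$ for distinct $i,j,k$; $[F_{ij}(a),F_{kl}(b)]=0$ for $j\ne k$, $i\ne l$. *)

theory Defs
  imports "HOL-Algebra.AbelCoset" "HOL-Algebra.Module" "HOL-Library.Z2"
begin

section \<open>Superalgebras\<close>

text \<open>
  Degrees are elements of the two-element field \<^typ>\<open>bit\<close>, so that degrees add and multiply as in
  Z/2.  The homogeneous component of degree p is \<open>homog M p\<close>; zero is homogeneous of both degrees.
  The slot \<^const>\<open>mult\<close> holds the product of an associative superalgebra and likewise the bracket of
  a Lie superalgebra; for the latter the slot \<^const>\<open>one\<close> carries no meaning and is never referred to.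
\<close>

record ('k, 'a) superalgebra = "('k, 'a) module" +
  homog :: "bit \<Rightarrow> 'a set"

locale super_module = module K M for K (structure) and M (structure) +
  assumes homog_submodule: "submodule (homog M p) K M"
    and homog_decomp: "x \<in> carrier M \<Longrightarrow>
      \<exists>!yz. yz \<in> homog M 0 \<times> homog M 1 \<and> x = fst yz \<oplus>\<^bsub>M\<^esub> snd yz"

locale nonassoc_superalgebra = super_module K M for K (structure) and M (structure) +
  assumes prod_closed: "\<lbrakk>x \<in> carrier M; y \<in> carrier M\<rbrakk> \<Longrightarrow> x \<otimes>\<^bsub>M\<^esub> y \<in> carrier M"
    and prod_add_left: "\<lbrakk>x \<in> carrier M; y \<in> carrier M; z \<in> carrier M\<rbrakk> \<Longrightarrow>
      (x \<oplus>\<^bsub>M\<^esub> y) \<otimes>\<^bsub>M\<^esub> z = x \<otimes>\<^bsub>M\<^esub> z \<oplus>\<^bsub>M\<^esub> y \<otimes>\<^bsub>M\<^esub> z"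
    and prod_add_right: "\<lbrakk>x \<in> carrier M; y \<in> carrier M; z \<in> carrier M\<rbrakk> \<Longrightarrow>
      x \<otimes>\<^bsub>M\<^esub> (y \<oplus>\<^bsub>M\<^esub> z) = x \<otimes>\<^bsub>M\<^esub> y \<oplus>\<^bsub>M\<^esub> x \<otimes>\<^bsub>M\<^esub> z"
    and prod_smult_left: "\<lbrakk>c \<in> carrier K; x \<in> carrier M; y \<in> carrier M\<rbrakk> \<Longrightarrow>
      (c \<odot>\<^bsub>M\<^esub> x) \<otimes>\<^bsub>M\<^esub> y = c \<odot>\<^bsub>M\<^esub> (x \<otimes>\<^bsub>M\<^esub> y)"
    and prod_smult_right: "\<lbrakk>c \<in> carrier K; x \<in> carrier M; y \<in> carrier M\<rbrakk> \<Longrightarrow>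
      x \<otimes>\<^bsub>M\<^esub> (c \<odot>\<^bsub>M\<^esub> y) = c \<odot>\<^bsub>M\<^esub> (x \<otimes>\<^bsub>M\<^esub> y)"
    and prod_even: "\<lbrakk>x \<in> homog M p; y \<in> homog M q\<rbrakk> \<Longrightarrow> x \<otimes>\<^bsub>M\<^esub> y \<in> homog M (p + q)"

locale assoc_superalgebra = nonassoc_superalgebra K A + Group.monoid A
  for K (structure) and A (structure)

text \<open>\<open>koszul_sign M e x\<close> is \<open>(-1)\<^sup>e x\<close>.\<close>

definition koszul_sign :: "('a, 'm) ring_scheme \<Rightarrow> bit \<Rightarrow> 'a \<Rightarrow> 'a" where
  "koszul_sign M e x = (if e = 1 then \<ominus>\<^bsub>M\<^esub> x else x)"

locale lie_superalgebra = nonassoc_superalgebra K L for K (structure) and L (structure) +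
  assumes super_skew: "\<lbrakk>x \<in> homog L p; y \<in> homog L q\<rbrakk> \<Longrightarrow>
      x \<otimes>\<^bsub>L\<^esub> y = \<ominus>\<^bsub>L\<^esub> koszul_sign L (p * q) (y \<otimes>\<^bsub>L\<^esub> x)"
    and even_alternating: "x \<in> homog L 0 \<Longrightarrow> x \<otimes>\<^bsub>L\<^esub> x = \<zero>\<^bsub>L\<^esub>"
    and super_jacobi: "\<lbrakk>x \<in> homog L p; y \<in> homog L q; z \<in> homog L r\<rbrakk> \<Longrightarrow>
      koszul_sign L (p * r) ((x \<otimes>\<^bsub>L\<^esub> y) \<otimes>\<^bsub>L\<^esub> z) \<oplus>\<^bsub>L\<^esub> koszul_sign L (p * q) ((y \<otimes>\<^bsub>L\<^esub> z) \<otimes>\<^bsub>L\<^esub> x)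
        \<oplus>\<^bsub>L\<^esub> koszul_sign L (q * r) ((z \<otimes>\<^bsub>L\<^esub> x) \<otimes>\<^bsub>L\<^esub> y) = \<zero>\<^bsub>L\<^esub>"

definition lie_hom :: "('k, 'r) ring_scheme \<Rightarrow> ('k, 'a, 'm) superalgebra_scheme \<Rightarrow>
    ('k, 'b, 'n) superalgebra_scheme \<Rightarrow> ('a \<Rightarrow> 'b) set" where
  "lie_hom K L M = {f. f \<in> carrier L \<rightarrow> carrier M
     \<and> (\<forall>x\<in>carrier L. \<forall>y\<in>carrier L. f (x \<oplus>\<^bsub>L\<^esub> y) = f x \<oplus>\<^bsub>M\<^esub> f y)
     \<and> (\<forall>c\<in>carrier K. \<forall>x\<in>carrier L. f (c \<odot>\<^bsub>L\<^esub> x) = c \<odot>\<^bsub>M\<^esub> f x)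
     \<and> (\<forall>x\<in>carrier L. \<forall>y\<in>carrier L. f (x \<otimes>\<^bsub>L\<^esub> y) = f x \<otimes>\<^bsub>M\<^esub> f y)
     \<and> (\<forall>p. f ` homog L p \<subseteq> homog M p)}"

definition lie_centre :: "('k, 'a, 'm) superalgebra_scheme \<Rightarrow> 'a set" where
  "lie_centre L = {z \<in> carrier L. \<forall>x\<in>carrier L. z \<otimes>\<^bsub>L\<^esub> x = \<zero>\<^bsub>L\<^esub>}"

definition central_extension :: "('k, 'r) ring_scheme \<Rightarrow> ('k, 'b, 'n) superalgebra_scheme \<Rightarrow>
    ('k, 'a, 'm) superalgebra_scheme \<Rightarrow> ('b \<Rightarrow> 'a) \<Rightarrow> bool" where
  "central_extension K M L \<tau> \<longleftrightarrow> lie_superalgebra K M \<and> lie_superalgebra K L \<and>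
     \<tau> \<in> lie_hom K M L \<and> \<tau> ` carrier M = carrier L \<and> a_kernel M L \<tau> \<subseteq> lie_centre M"

definition free_basis :: "('k, 'r) ring_scheme \<Rightarrow> ('k, 'a, 'm) module_scheme \<Rightarrow> 'a set \<Rightarrow> bool" where
  "free_basis K M B \<longleftrightarrow> B \<subseteq> carrier M \<and>
     (\<forall>x\<in>carrier M. \<exists>!c. c \<in> B \<rightarrow>\<^sub>E carrier K \<and> finite {b \<in> B. c b \<noteq> \<zero>\<^bsub>K\<^esub>} \<and>
        x = (\<Oplus>\<^bsub>M\<^esub>b\<in>{b \<in> B. c b \<noteq> \<zero>\<^bsub>K\<^esub>}. c b \<odot>\<^bsub>M\<^esub> b))"


section \<open>Lie superalgebras given by homogeneous generators and relations\<close>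

text \<open>
  The Lie superalgebra over K generated by a set X of symbols, where \<open>x \<in> X\<close> has degree \<open>d x\<close>,
  subject to a set R of relations \<open>s = t\<close> between homogeneous terms s, t of equal degree: formal
  terms modulo the least congruence that contains R and all instances of the Lie superalgebra axioms.
\<close>

datatype ('k, 'x) lterm =
    Gen 'x
  | Zero
  | Add "('k, 'x) lterm" "('k, 'x) lterm"
  | Neg "('k, 'x) lterm"
  | Smul 'k "('k, 'x) lterm"
  | Br "('k, 'x) lterm" "('k, 'x) lterm"

inductive_set lterms :: "('k, 'r) ring_scheme \<Rightarrow> 'x set \<Rightarrow> ('k, 'x) lterm set"
  for K and X where
  "x \<in> X \<Longrightarrow> Gen x \<in> lterms K X"
| "Zero \<in> lterms K X"
| "\<lbrakk>s \<in> lterms K X; t \<in> lterms K X\<rbrakk> \<Longrightarrow> Add s t \<in> lterms K X"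
| "t \<in> lterms K X \<Longrightarrow> Neg t \<in> lterms K X"
| "\<lbrakk>c \<in> carrier K; t \<in> lterms K X\<rbrakk> \<Longrightarrow> Smul c t \<in> lterms K X"
| "\<lbrakk>s \<in> lterms K X; t \<in> lterms K X\<rbrakk> \<Longrightarrow> Br s t \<in> lterms K X"

inductive has_deg ::
    "('k, 'r) ring_scheme \<Rightarrow> 'x set \<Rightarrow> ('x \<Rightarrow> bit) \<Rightarrow> bit \<Rightarrow> ('k, 'x) lterm \<Rightarrow> bool"
  for K and X and d where
  "x \<in> X \<Longrightarrow> has_deg K X d (d x) (Gen x)"
| "has_deg K X d p Zero"
| "\<lbrakk>has_deg K X d p s; has_deg K X d p t\<rbrakk> \<Longrightarrow> has_deg K X d p (Add s t)"
| "has_deg K X d p t \<Longrightarrow> has_deg K X d p (Neg t)"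
| "\<lbrakk>c \<in> carrier K; has_deg K X d p t\<rbrakk> \<Longrightarrow> has_deg K X d p (Smul c t)"
| "\<lbrakk>has_deg K X d p s; has_deg K X d q t\<rbrakk> \<Longrightarrow> has_deg K X d (p + q) (Br s t)"

definition Sgn :: "bit \<Rightarrow> ('k, 'x) lterm \<Rightarrow> ('k, 'x) lterm" where
  "Sgn e t = (if e = 1 then Neg t else t)"

inductive_set lcong :: "('k, 'r) ring_scheme \<Rightarrow> 'x set \<Rightarrow> ('x \<Rightarrow> bit) \<Rightarrow>
    (('k, 'x) lterm \<times> ('k, 'x) lterm) set \<Rightarrow> (('k, 'x) lterm \<times> ('k, 'x) lterm) set"
  for K (structure) and X and d and R where
  relation: "(s, t) \<in> R \<Longrightarrow> (s, t) \<in> lcong K X d R"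
| refl: "t \<in> lterms K X \<Longrightarrow> (t, t) \<in> lcong K X d R"
| sym: "(s, t) \<in> lcong K X d R \<Longrightarrow> (t, s) \<in> lcong K X d R"
| trans: "\<lbrakk>(s, t) \<in> lcong K X d R; (t, u) \<in> lcong K X d R\<rbrakk> \<Longrightarrow> (s, u) \<in> lcong K X d R"
| Add_cong: "\<lbrakk>(s, s') \<in> lcong K X d R; (t, t') \<in> lcong K X d R\<rbrakk> \<Longrightarrow>
    (Add s t, Add s' t') \<in> lcong K X d R"
| Neg_cong: "(t, t') \<in> lcong K X d R \<Longrightarrow> (Neg t, Neg t') \<in> lcong K X d R"
| Smul_cong: "\<lbrakk>c \<in> carrier K; (t, t') \<in> lcong K X d R\<rbrakk> \<Longrightarrow>
    (Smul c t, Smul c t') \<in> lcong K X d R"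
| Br_cong: "\<lbrakk>(s, s') \<in> lcong K X d R; (t, t') \<in> lcong K X d R\<rbrakk> \<Longrightarrow>
    (Br s t, Br s' t') \<in> lcong K X d R"
| Add_assoc: "\<lbrakk>s \<in> lterms K X; t \<in> lterms K X; u \<in> lterms K X\<rbrakk> \<Longrightarrow>
    (Add (Add s t) u, Add s (Add t u)) \<in> lcong K X d R"
| Add_comm: "\<lbrakk>s \<in> lterms K X; t \<in> lterms K X\<rbrakk> \<Longrightarrow> (Add s t, Add t s) \<in> lcong K X d R"
| Add_Zero: "t \<in> lterms K X \<Longrightarrow> (Add t Zero, t) \<in> lcong K X d R"
| Add_Neg: "t \<in> lterms K X \<Longrightarrow> (Add t (Neg t), Zero) \<in> lcong K X d R"
| Smul_add: "\<lbrakk>b \<in> carrier K; c \<in> carrier K; t \<in> lterms K X\<rbrakk> \<Longrightarrow>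
    (Smul (b \<oplus> c) t, Add (Smul b t) (Smul c t)) \<in> lcong K X d R"
| Smul_Add: "\<lbrakk>c \<in> carrier K; s \<in> lterms K X; t \<in> lterms K X\<rbrakk> \<Longrightarrow>
    (Smul c (Add s t), Add (Smul c s) (Smul c t)) \<in> lcong K X d R"
| Smul_mult: "\<lbrakk>b \<in> carrier K; c \<in> carrier K; t \<in> lterms K X\<rbrakk> \<Longrightarrow>
    (Smul (b \<otimes> c) t, Smul b (Smul c t)) \<in> lcong K X d R"
| Smul_one: "t \<in> lterms K X \<Longrightarrow> (Smul \<one> t, t) \<in> lcong K X d R"
| Br_Add_left: "\<lbrakk>s \<in> lterms K X; t \<in> lterms K X; u \<in> lterms K X\<rbrakk> \<Longrightarrow>
    (Br (Add s t) u, Add (Br s u) (Br t u)) \<in> lcong K X d R"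
| Br_Add_right: "\<lbrakk>s \<in> lterms K X; t \<in> lterms K X; u \<in> lterms K X\<rbrakk> \<Longrightarrow>
    (Br s (Add t u), Add (Br s t) (Br s u)) \<in> lcong K X d R"
| Br_Smul_left: "\<lbrakk>c \<in> carrier K; s \<in> lterms K X; t \<in> lterms K X\<rbrakk> \<Longrightarrow>
    (Br (Smul c s) t, Smul c (Br s t)) \<in> lcong K X d R"
| Br_Smul_right: "\<lbrakk>c \<in> carrier K; s \<in> lterms K X; t \<in> lterms K X\<rbrakk> \<Longrightarrow>
    (Br s (Smul c t), Smul c (Br s t)) \<in> lcong K X d R"
| Br_skew: "\<lbrakk>has_deg K X d p s; has_deg K X d q t\<rbrakk> \<Longrightarrow>
    (Br s t, Neg (Sgn (p * q) (Br t s))) \<in> lcong K X d R"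
| Br_alternating: "has_deg K X d 0 t \<Longrightarrow> (Br t t, Zero) \<in> lcong K X d R"
| Br_jacobi: "\<lbrakk>has_deg K X d p s; has_deg K X d q t; has_deg K X d r u\<rbrakk> \<Longrightarrow>
    (Add (Add (Sgn (p * r) (Br (Br s t) u)) (Sgn (p * q) (Br (Br t u) s)))
       (Sgn (q * r) (Br (Br u s) t)), Zero) \<in> lcong K X d R"

definition presented_lie :: "('k, 'r) ring_scheme \<Rightarrow> 'x set \<Rightarrow> ('x \<Rightarrow> bit) \<Rightarrow>
    (('k, 'x) lterm \<times> ('k, 'x) lterm) set \<Rightarrow> ('k, ('k, 'x) lterm set) superalgebra" where
  "presented_lie K X d R =
    \<lparr> carrier = lterms K X // lcong K X d R,
      mult = (\<lambda>S T. \<Union>s\<in>S. \<Union>t\<in>T. lcong K X d R `` {Br s t}),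
      one = undefined,
      zero = lcong K X d R `` {Zero},
      add = (\<lambda>S T. \<Union>s\<in>S. \<Union>t\<in>T. lcong K X d R `` {Add s t}),
      smult = (\<lambda>c T. \<Union>t\<in>T. lcong K X d R `` {Smul c t}),
      homog = (\<lambda>p. {t. has_deg K X d p t} // lcong K X d R) \<rparr>"


section \<open>The Steinberg Lie superalgebra st(2,1,A)\<close>

definition index_deg :: "nat \<Rightarrow> bit" where
  "index_deg i = (if i = 3 then 1 else 0)"

text \<open>
  The symbol \<open>(i, j, p, a)\<close> stands for \<open>F\<^sub>i\<^sub>j(a)\<close> with \<open>a\<close> homogeneous of degree p.  Recording p makes
  the degree of the symbol well defined also for \<open>a = 0\<close>; by linearity both symbols for \<open>F\<^sub>i\<^sub>j(0)\<close>
  vanish.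
\<close>

type_synonym 'a st_gen = "nat \<times> nat \<times> bit \<times> 'a"

definition st_gens :: "('k, 'a, 'm) superalgebra_scheme \<Rightarrow> 'a st_gen set" where
  "st_gens A = {(i, j, p, a). i \<in> {1..3} \<and> j \<in> {1..3} \<and> i \<noteq> j \<and> a \<in> homog A p}"

definition st_deg :: "'a st_gen \<Rightarrow> bit" where
  "st_deg = (\<lambda>(i, j, p, a). index_deg i + index_deg j + p)"

abbreviation Fgen :: "nat \<Rightarrow> nat \<Rightarrow> bit \<Rightarrow> 'a \<Rightarrow> ('k, 'a st_gen) lterm" where
  "Fgen i j p a \<equiv> Gen (i, j, p, a)"

inductive_set st_rels :: "('k, 'r) ring_scheme \<Rightarrow> ('k, 'a, 'm) superalgebra_scheme \<Rightarrow>
    (('k, 'a st_gen) lterm \<times> ('k, 'a st_gen) lterm) set"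
  for K and A where
  F_add: "\<lbrakk>i \<in> {1..3}; j \<in> {1..3}; i \<noteq> j; a \<in> homog A p; b \<in> homog A p\<rbrakk> \<Longrightarrow>
    (Fgen i j p (a \<oplus>\<^bsub>A\<^esub> b), Add (Fgen i j p a) (Fgen i j p b)) \<in> st_rels K A"
| F_smult: "\<lbrakk>i \<in> {1..3}; j \<in> {1..3}; i \<noteq> j; c \<in> carrier K; a \<in> homog A p\<rbrakk> \<Longrightarrow>
    (Fgen i j p (c \<odot>\<^bsub>A\<^esub> a), Smul c (Fgen i j p a)) \<in> st_rels K A"
| F_Br: "\<lbrakk>i \<in> {1..3}; j \<in> {1..3}; k \<in> {1..3}; distinct [i, j, k]; a \<in> homog A p; b \<in> homog A q\<rbrakk> \<Longrightarrow>
    (Br (Fgen i j p a) (Fgen j k q b), Fgen i k (p + q) (a \<otimes>\<^bsub>A\<^esub> b)) \<in> st_rels K A"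
| F_Br_Zero: "\<lbrakk>i \<in> {1..3}; j \<in> {1..3}; k \<in> {1..3}; l \<in> {1..3}; i \<noteq> j; k \<noteq> l; j \<noteq> k; i \<noteq> l;
      a \<in> homog A p; b \<in> homog A q\<rbrakk> \<Longrightarrow>
    (Br (Fgen i j p a) (Fgen k l q b), Zero) \<in> st_rels K A"

definition steinberg :: "('k, 'r) ring_scheme \<Rightarrow> ('k, 'a, 'm) superalgebra_scheme \<Rightarrow>
    ('k, ('k, 'a st_gen) lterm set) superalgebra" where
  "steinberg K A = presented_lie K (st_gens A) st_deg (st_rels K A)"

end

theory Submission
  imports Defs
begin

text \<open>
  Since the kernel of \<open>\<tau> : M \<rightarrow> st(2,1,A)\<close> is central, the bracket of two elements of M depends only on
  their images under \<open>\<tau>\<close>.  Every generator is a bracket, \<open>F\<^sub>i\<^sub>j(a) = [F\<^sub>i\<^sub>k(a), F\<^sub>k\<^sub>j(1)]\<close> with k the third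
  index, so a section must send \<open>F\<^sub>i\<^sub>j(a)\<close> to the bracket of arbitrary lifts of \<open>F\<^sub>i\<^sub>k(a)\<close> and \<open>F\<^sub>k\<^sub>j(1)\<close>.
  This gives uniqueness.  Existence means that these forced values satisfy the Steinberg relations.
  Linearity in a is clear; what remains is that the bracket of lifts of \<open>F\<^sub>i\<^sub>j(a)\<close> and \<open>F\<^sub>j\<^sub>k(b)\<close>
  depends on a and b only through the product ab (\<open>lifts_prod_move\<close>), and that the bracket of lifts of
  \<open>F\<^sub>i\<^sub>j(a)\<close> and \<open>F\<^sub>k\<^sub>l(b)\<close> is zero for \<open>j \<noteq> k\<close>, \<open>i \<noteq> l\<close> (\<open>lifts_prod_zero\<close>).

  Both follow from weights.  For \<open>{s, t} = {1, 2}\<close> put \<open>h\<^sub>t = [F\<^sub>s\<^sub>3(1), F\<^sub>3\<^sub>s(1)]\<close>.  The two factors are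
  odd, so \<open>h\<^sub>t\<close> acts like the matrix \<open>e\<^sub>s\<^sub>s + e\<^sub>3\<^sub>3\<close>, that is like \<open>- e\<^sub>t\<^sub>t\<close> up to the identity matrix:
  \<open>F\<^sub>i\<^sub>j(a)\<close> is an eigenvector with eigenvalue \<open>\<delta>\<^sub>j\<^sub>t - \<delta>\<^sub>i\<^sub>t\<close> (\<open>weight_elem_prod\<close>).  A lift H of \<open>h\<^sub>t\<close> acts
  on M as an even derivation, so lifts m, n of eigenvectors with eigenvalues c, d satisfy
  \<open>[H, [m, n]] = (c + d) [m, n]\<close>.  The left side depends only on \<open>\<tau> [m, n]\<close>.  Hence \<open>[m, n]\<close> is
  determined by \<open>\<tau> [m, n]\<close> as soon as \<open>c + d = \<plusminus>1\<close> (\<open>prod_lifts_eq_if_unit_weight\<close>).  For each relation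
  in question t can be chosen so that this holds, except for the bracket of lifts of \<open>F\<^sub>i\<^sub>j(a)\<close> and
  \<open>F\<^sub>i\<^sub>j(b)\<close>; there one writes \<open>F\<^sub>i\<^sub>j(a) = [F\<^sub>i\<^sub>k(a), F\<^sub>k\<^sub>j(1)]\<close> and applies the Jacobi identity.

  It is the odd index 3 that makes the weights small enough.  If all indices were even, the
  corresponding element would act like \<open>e\<^sub>s\<^sub>s - e\<^sub>3\<^sub>3\<close>, and the total weight of a pair \<open>F\<^sub>i\<^sub>j, F\<^sub>i\<^sub>k\<close> would
  always be a multiple of 3.
\<close>

section \<open>Homogeneous parts and derivations\<close>

context super_module
begin

lemma homog_carrier: "x \<in> homog M p \<Longrightarrow> x \<in> carrier M"
  using submoduleE(1)[OF homog_submodule] by blast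

lemma homog_zero [simp]: "\<zero>\<^bsub>M\<^esub> \<in> homog M p"
  using subgroup.one_closed[OF submodule.axioms(1)[OF homog_submodule]] by simp

lemma homog_add: "\<lbrakk>x \<in> homog M p; y \<in> homog M p\<rbrakk> \<Longrightarrow> x \<oplus>\<^bsub>M\<^esub> y \<in> homog M p"
  by (rule submoduleE(5)[OF homog_submodule])

lemma homog_neg: "x \<in> homog M p \<Longrightarrow> \<ominus>\<^bsub>M\<^esub> x \<in> homog M p"
  by (rule submoduleE(3)[OF homog_submodule])

lemma homog_smult: "\<lbrakk>c \<in> carrier K; x \<in> homog M p\<rbrakk> \<Longrightarrow> c \<odot>\<^bsub>M\<^esub> x \<in> homog M p"
  by (rule submoduleE(4)[OF homog_submodule])

lemma koszul_sign_closed [simp]: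
  "x \<in> carrier M \<Longrightarrow> koszul_sign M e x \<in> carrier M"
  by (simp add: koszul_sign_def)

lemma koszul_sign_zero [simp]: "koszul_sign M e \<zero>\<^bsub>M\<^esub> = \<zero>\<^bsub>M\<^esub>"
  by (simp add: koszul_sign_def)

lemma koszul_sign_koszul_sign:
  "x \<in> carrier M \<Longrightarrow> koszul_sign M e (koszul_sign M f x) = koszul_sign M (e + f) x"
  by (cases e; cases f) (simp_all add: koszul_sign_def)

lemma koszul_sign_neg:
  "x \<in> carrier M \<Longrightarrow> koszul_sign M e (\<ominus>\<^bsub>M\<^esub> x) = \<ominus>\<^bsub>M\<^esub> koszul_sign M e x"
  by (simp add: koszul_sign_def)

lemma koszul_sign_add:
  "\<lbrakk>x \<in> carrier M; y \<in> carrier M\<rbrakk> \<Longrightarrow>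
    koszul_sign M e (x \<oplus>\<^bsub>M\<^esub> y) = koszul_sign M e x \<oplus>\<^bsub>M\<^esub> koszul_sign M e y"
  by (simp add: koszul_sign_def M.minus_add)

lemma koszul_sign_eq_zero: "x \<in> carrier M \<Longrightarrow> koszul_sign M e x = \<zero>\<^bsub>M\<^esub> \<longleftrightarrow> x = \<zero>\<^bsub>M\<^esub>"
  by (simp add: koszul_sign_def M.add.inv_eq_1_iff)

lemma homog_parts_exist:
  assumes "x \<in> carrier M"
  obtains y z where "y \<in> homog M p" "z \<in> homog M (p + 1)" "x = y \<oplus>\<^bsub>M\<^esub> z"
proof -
  obtain y0 y1 where y: "y0 \<in> homog M 0" "y1 \<in> homog M 1" "x = y0 \<oplus>\<^bsub>M\<^esub> y1"
    using ex1_implies_ex[OF homog_decomp[OF assms]] by auto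
  show ?thesis
  proof (cases p)
    case zero
    with y show ?thesis by (intro that[of y0 y1]) auto
  next
    case one
    with y show ?thesis
      by (intro that[of y1 y0]) (simp_all add: M.a_comm homog_carrier)
  qed
qed

lemma homog_parts_unique:
  assumes "y \<in> homog M p" "y' \<in> homog M p" "z \<in> homog M (p + 1)" "z' \<in> homog M (p + 1)"
    and "y \<oplus>\<^bsub>M\<^esub> z = y' \<oplus>\<^bsub>M\<^esub> z'"
  shows "y = y'" "z = z'"
proof -
  have carr: "y \<in> carrier M" "y' \<in> carrier M" "z \<in> carrier M" "z' \<in> carrier M"
    using assms homog_carrier by blast+
  have uniq: "u = u' \<and> v = v'"
    if "u \<in> homog M 0" "u' \<in> homog M 0" "v \<in> homog M 1" "v' \<in> homog M 1"
      "u \<oplus>\<^bsub>M\<^esub> v = u' \<oplus>\<^bsub>M\<^esub> v'" for u u' v v'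
  proof -
    have "u \<oplus>\<^bsub>M\<^esub> v \<in> carrier M"
      using that homog_carrier by blast
    then have "\<exists>!yz. yz \<in> homog M 0 \<times> homog M 1 \<and> u \<oplus>\<^bsub>M\<^esub> v = fst yz \<oplus>\<^bsub>M\<^esub> snd yz"
      by (rule homog_decomp)
    then have "(u, v) = (u', v')"
      using that by (elim ex1E) (metis SigmaI fst_conv snd_conv)
    then show ?thesis by simp
  qed
  have "y = y' \<and> z = z'"
  proof (cases p)
    case zero
    with assms uniq[of y y' z z'] show ?thesis by simp
  next
    case one
    with assms uniq[of z z' y y'] show ?thesis
      using carr by (simp add: a_comm)
  qed
  then show "y = y'" "z = z'" by blast+
qed

end

context nonassoc_superalgebra
begin

lemma prod_zero_left [simp]: "x \<in> carrier M \<Longrightarrow> \<zero>\<^bsub>M\<^esub> \<otimes>\<^bsub>M\<^esub> x = \<zero>\<^bsub>M\<^esub>"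
  using prod_smult_left[of \<zero> "\<zero>\<^bsub>M\<^esub>" x] prod_closed[of "\<zero>\<^bsub>M\<^esub>" x] by simp

lemma prod_zero_right [simp]: "x \<in> carrier M \<Longrightarrow> x \<otimes>\<^bsub>M\<^esub> \<zero>\<^bsub>M\<^esub> = \<zero>\<^bsub>M\<^esub>"
  using prod_smult_right[of \<zero> x "\<zero>\<^bsub>M\<^esub>"] prod_closed[of x "\<zero>\<^bsub>M\<^esub>"] by simp

lemma smult_minus_one: "x \<in> carrier M \<Longrightarrow> (\<ominus> \<one>) \<odot>\<^bsub>M\<^esub> x = \<ominus>\<^bsub>M\<^esub> x"
  by (simp add: smult_l_minus)

lemma prod_neg_left:
  "\<lbrakk>x \<in> carrier M; y \<in> carrier M\<rbrakk> \<Longrightarrow> (\<ominus>\<^bsub>M\<^esub> x) \<otimes>\<^bsub>M\<^esub> y = \<ominus>\<^bsub>M\<^esub> (x \<otimes>\<^bsub>M\<^esub> y)"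
  using prod_smult_left[of "\<ominus> \<one>" x y] prod_closed[of x y] by (simp add: smult_minus_one)

lemma prod_neg_right:
  "\<lbrakk>x \<in> carrier M; y \<in> carrier M\<rbrakk> \<Longrightarrow> x \<otimes>\<^bsub>M\<^esub> (\<ominus>\<^bsub>M\<^esub> y) = \<ominus>\<^bsub>M\<^esub> (x \<otimes>\<^bsub>M\<^esub> y)"
  using prod_smult_right[of "\<ominus> \<one>" x y] prod_closed[of x y] by (simp add: smult_minus_one)

lemma prod_koszul_sign_left:
  "\<lbrakk>x \<in> carrier M; y \<in> carrier M\<rbrakk> \<Longrightarrow>
    koszul_sign M e x \<otimes>\<^bsub>M\<^esub> y = koszul_sign M e (x \<otimes>\<^bsub>M\<^esub> y)"
  by (simp add: koszul_sign_def prod_neg_left)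

lemma prod_koszul_sign_right:
  "\<lbrakk>x \<in> carrier M; y \<in> carrier M\<rbrakk> \<Longrightarrow>
    x \<otimes>\<^bsub>M\<^esub> koszul_sign M e y = koszul_sign M e (x \<otimes>\<^bsub>M\<^esub> y)"
  by (simp add: koszul_sign_def prod_neg_right)

end

text \<open>
  If \<open>1 = e + f\<close> with e even and f odd, then comparing the parts of \<open>e = e 1\<close> and \<open>f = f 1\<close> gives
  \<open>e f = 0\<close> and \<open>f f = 0\<close>, hence \<open>f = 1 f = 0\<close>.
\<close>

lemma (in assoc_superalgebra) one_even: "\<one>\<^bsub>A\<^esub> \<in> homog A 0"
proof -
  obtain e f where ef: "e \<in> homog A 0" "f \<in> homog A 1" "\<one>\<^bsub>A\<^esub> = e \<oplus>\<^bsub>A\<^esub> f"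
    using homog_parts_exist[OF one_closed, of 0] by auto
  have e: "e \<in> carrier A" and f: "f \<in> carrier A"
    using ef homog_carrier by blast+
  have "e \<otimes>\<^bsub>A\<^esub> e \<oplus>\<^bsub>A\<^esub> e \<otimes>\<^bsub>A\<^esub> f = e \<oplus>\<^bsub>A\<^esub> \<zero>\<^bsub>A\<^esub>" "f \<otimes>\<^bsub>A\<^esub> e \<oplus>\<^bsub>A\<^esub> f \<otimes>\<^bsub>A\<^esub> f = f \<oplus>\<^bsub>A\<^esub> \<zero>\<^bsub>A\<^esub>"
    using e f ef(3) by (metis prod_add_right r_one M.r_zero)+
  moreover have "e \<otimes>\<^bsub>A\<^esub> e \<in> homog A 0" "e \<otimes>\<^bsub>A\<^esub> f \<in> homog A 1" "f \<otimes>\<^bsub>A\<^esub> e \<in> homog A 1"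
    "f \<otimes>\<^bsub>A\<^esub> f \<in> homog A 0"
    using prod_even ef(1,2) by fastforce+
  ultimately have "e \<otimes>\<^bsub>A\<^esub> f = \<zero>\<^bsub>A\<^esub>" "f \<otimes>\<^bsub>A\<^esub> f = \<zero>\<^bsub>A\<^esub>"
    using homog_parts_unique(2)[of "e \<otimes>\<^bsub>A\<^esub> e" 0 e "e \<otimes>\<^bsub>A\<^esub> f" "\<zero>\<^bsub>A\<^esub>"]
      homog_parts_unique(2)[of "f \<otimes>\<^bsub>A\<^esub> e" 1 f "f \<otimes>\<^bsub>A\<^esub> f" "\<zero>\<^bsub>A\<^esub>"] ef(1,2)
    by auto
  then have "f = \<zero>\<^bsub>A\<^esub>"
    using e f ef(3) by (metis prod_add_left l_one M.r_zero M.zero_closed)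
  then show ?thesis
    using ef e by simp
qed

context lie_superalgebra
begin

text \<open>
  The Jacobi identity in the form that the left multiplications are superderivations.  After skew
  symmetry has been used to rearrange the three terms, they share the sign \<open>(-1)\<^sup>p\<^sup>r\<close>, which cancels.
\<close>

lemma super_leibniz:
  assumes "x \<in> homog L p" "y \<in> homog L q" "z \<in> homog L r"
  shows "x \<otimes>\<^bsub>L\<^esub> (y \<otimes>\<^bsub>L\<^esub> z) =
    (x \<otimes>\<^bsub>L\<^esub> y) \<otimes>\<^bsub>L\<^esub> z \<oplus>\<^bsub>L\<^esub> koszul_sign L (p * q) (y \<otimes>\<^bsub>L\<^esub> (x \<otimes>\<^bsub>L\<^esub> z))"
proof -
  have x: "x \<in> carrier L" and y: "y \<in> carrier L" and z: "z \<in> carrier L"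
    using assms homog_carrier by blast+
  define a b c where "a = (x \<otimes>\<^bsub>L\<^esub> y) \<otimes>\<^bsub>L\<^esub> z" and "b = x \<otimes>\<^bsub>L\<^esub> (y \<otimes>\<^bsub>L\<^esub> z)" and "c = y \<otimes>\<^bsub>L\<^esub> (x \<otimes>\<^bsub>L\<^esub> z)"
  have carr: "a \<in> carrier L" "b \<in> carrier L" "c \<in> carrier L"
    by (simp_all add: a_def b_def c_def x y z prod_closed)
  have "(y \<otimes>\<^bsub>L\<^esub> z) \<otimes>\<^bsub>L\<^esub> x = \<ominus>\<^bsub>L\<^esub> koszul_sign L ((q + r) * p) b"
    unfolding b_def by (rule super_skew[OF prod_even[OF assms(2,3)] assms(1)])
  moreover have "(z \<otimes>\<^bsub>L\<^esub> x) \<otimes>\<^bsub>L\<^esub> y = koszul_sign L ((r + p) * q + r * p) c"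
    using super_skew[OF prod_even[OF assms(3,1)] assms(2)] super_skew[OF assms(3,1)] carr
    by (simp add: c_def x y z prod_closed prod_neg_right prod_koszul_sign_right
        koszul_sign_koszul_sign koszul_sign_neg)
  ultimately have J0: "koszul_sign L (p * r) a \<oplus>\<^bsub>L\<^esub> koszul_sign L (p * q) (\<ominus>\<^bsub>L\<^esub> koszul_sign L ((q + r) * p) b)
      \<oplus>\<^bsub>L\<^esub> koszul_sign L (q * r) (koszul_sign L ((r + p) * q + r * p) c) = \<zero>\<^bsub>L\<^esub>"
    using super_jacobi[OF assms] by (simp add: a_def)
  define d where "d = koszul_sign L (p * q) c"
  have d: "d \<in> carrier L" by (simp add: d_def carr)
  have J: "koszul_sign L (p * r) a \<oplus>\<^bsub>L\<^esub> \<ominus>\<^bsub>L\<^esub> koszul_sign L (p * r) b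
      \<oplus>\<^bsub>L\<^esub> koszul_sign L (p * r) d = \<zero>\<^bsub>L\<^esub>"
    using carr J0 unfolding d_def
    by (cases p; cases q; cases r) (simp_all add: koszul_sign_def)
  have "koszul_sign L (p * r) (a \<oplus>\<^bsub>L\<^esub> \<ominus>\<^bsub>L\<^esub> b \<oplus>\<^bsub>L\<^esub> d) = \<zero>\<^bsub>L\<^esub>"
    using J carr d by (simp only: koszul_sign_add koszul_sign_neg M.add.m_closed M.a_inv_closed)
  then have sum: "a \<oplus>\<^bsub>L\<^esub> \<ominus>\<^bsub>L\<^esub> b \<oplus>\<^bsub>L\<^esub> d = \<zero>\<^bsub>L\<^esub>"
    using carr d by (simp add: koszul_sign_eq_zero)
  have "b = b \<oplus>\<^bsub>L\<^esub> (a \<oplus>\<^bsub>L\<^esub> \<ominus>\<^bsub>L\<^esub> b \<oplus>\<^bsub>L\<^esub> d)"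
    using carr by (simp add: sum)
  also have "\<dots> = a \<oplus>\<^bsub>L\<^esub> (b \<oplus>\<^bsub>L\<^esub> \<ominus>\<^bsub>L\<^esub> b) \<oplus>\<^bsub>L\<^esub> d"
    using carr d by (simp only: M.a_ac M.a_closed M.a_inv_closed)
  also have "\<dots> = a \<oplus>\<^bsub>L\<^esub> d"
    using carr d by (simp add: M.r_neg)
  finally have "b = a \<oplus>\<^bsub>L\<^esub> d" .
  then show ?thesis by (simp add: a_def b_def c_def d_def)
qed

lemma even_derivation:
  assumes "h \<in> homog L 0" "y \<in> homog L q" "z \<in> homog L r"
  shows "h \<otimes>\<^bsub>L\<^esub> (y \<otimes>\<^bsub>L\<^esub> z) = (h \<otimes>\<^bsub>L\<^esub> y) \<otimes>\<^bsub>L\<^esub> z \<oplus>\<^bsub>L\<^esub> y \<otimes>\<^bsub>L\<^esub> (h \<otimes>\<^bsub>L\<^esub> z)"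
  using super_leibniz[OF assms] by (simp add: koszul_sign_def)

text \<open>
  For odd x and y the action of \<open>[x, y]\<close> is the anticommutator of the actions of x and y; in this form
  no sign depends on the degree of z.
\<close>

lemma odd_prod_action:
  assumes "x \<in> homog L 1" "y \<in> homog L 1" "z \<in> homog L r"
  shows "(x \<otimes>\<^bsub>L\<^esub> y) \<otimes>\<^bsub>L\<^esub> z = x \<otimes>\<^bsub>L\<^esub> (y \<otimes>\<^bsub>L\<^esub> z) \<oplus>\<^bsub>L\<^esub> y \<otimes>\<^bsub>L\<^esub> (x \<otimes>\<^bsub>L\<^esub> z)"
proof -
  have c: "x \<in> carrier L" "y \<in> carrier L" "z \<in> carrier L"
    using assms homog_carrier by blast+
  show ?thesis
    using c by (simp add: super_leibniz[OF assms] koszul_sign_def prod_closed M.a_assoc M.l_neg)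
qed

end

section \<open>Homomorphisms out of a presented Lie superalgebra\<close>

lemma
  assumes "f \<in> lie_hom K L M"
  shows lie_hom_closed: "x \<in> carrier L \<Longrightarrow> f x \<in> carrier M"
    and lie_hom_add: "\<lbrakk>x \<in> carrier L; y \<in> carrier L\<rbrakk> \<Longrightarrow> f (x \<oplus>\<^bsub>L\<^esub> y) = f x \<oplus>\<^bsub>M\<^esub> f y"
    and lie_hom_smult: "\<lbrakk>c \<in> carrier K; x \<in> carrier L\<rbrakk> \<Longrightarrow> f (c \<odot>\<^bsub>L\<^esub> x) = c \<odot>\<^bsub>M\<^esub> f x"
    and lie_hom_prod: "\<lbrakk>x \<in> carrier L; y \<in> carrier L\<rbrakk> \<Longrightarrow> f (x \<otimes>\<^bsub>L\<^esub> y) = f x \<otimes>\<^bsub>M\<^esub> f y"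
    and lie_hom_homog: "x \<in> homog L p \<Longrightarrow> f x \<in> homog M p"
  using assms by (simp_all add: lie_hom_def Pi_iff image_subset_iff)

lemma lie_hom_id: "(\<lambda>x. x) \<in> lie_hom K L L"
  by (simp add: lie_hom_def)

lemma lie_hom_compose:
  assumes f: "f \<in> lie_hom K L M" and g: "g \<in> lie_hom K M N"
  shows "(\<lambda>x. g (f x)) \<in> lie_hom K L N"
  by (simp add: lie_hom_def[of K L N] Pi_iff image_subset_iff lie_hom_closed[OF f]
      lie_hom_closed[OF g] lie_hom_add[OF f] lie_hom_add[OF g] lie_hom_smult[OF f]
      lie_hom_smult[OF g] lie_hom_prod[OF f] lie_hom_prod[OF g] lie_hom_homog[OF f]
      lie_hom_homog[OF g])

lemma UN_eq_const: "\<lbrakk>a \<in> A; \<And>x. x \<in> A \<Longrightarrow> f x = c\<rbrakk> \<Longrightarrow> (\<Union>x\<in>A. f x) = c"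
  by blast

lemma Sgn_lterms: "t \<in> lterms K X \<Longrightarrow> Sgn e t \<in> lterms K X"
  by (simp add: Sgn_def lterms.intros)

lemma has_deg_lterms: "has_deg K X d p t \<Longrightarrow> t \<in> lterms K X"
  by (induction rule: has_deg.induct) (auto intro: lterms.intros)

primrec lterm_value :: "('k, 'b, 'n) superalgebra_scheme \<Rightarrow> ('x \<Rightarrow> 'b) \<Rightarrow> ('k, 'x) lterm \<Rightarrow> 'b" where
  "lterm_value M g (Gen x) = g x"
| "lterm_value M g Zero = \<zero>\<^bsub>M\<^esub>"
| "lterm_value M g (Add s t) = lterm_value M g s \<oplus>\<^bsub>M\<^esub> lterm_value M g t"
| "lterm_value M g (Neg t) = \<ominus>\<^bsub>M\<^esub> lterm_value M g t"
| "lterm_value M g (Smul c t) = c \<odot>\<^bsub>M\<^esub> lterm_value M g t"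
| "lterm_value M g (Br s t) = lterm_value M g s \<otimes>\<^bsub>M\<^esub> lterm_value M g t"

lemma lterm_value_Sgn: "lterm_value M g (Sgn e t) = koszul_sign M e (lterm_value M g t)"
  by (simp add: Sgn_def koszul_sign_def)

context lie_superalgebra
begin

lemma lterm_value_homog:
  assumes "has_deg K X d p t" "\<And>x. x \<in> X \<Longrightarrow> g x \<in> homog L (d x)"
  shows "lterm_value L g t \<in> homog L p"
  using assms(1)
proof (induction rule: has_deg.induct)
  case (6 p s q t)
  then show ?case unfolding lterm_value.simps by (intro prod_even)
qed (simp_all add: assms(2) homog_add homog_neg homog_smult)

lemma lterm_value_closed:
  assumes "t \<in> lterms K X" "\<And>x. x \<in> X \<Longrightarrow> g x \<in> homog L (d x)"
  shows "lterm_value L g t \<in> carrier L"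
  using assms(1)
  by (induction rule: lterms.induct) (simp_all add: homog_carrier[OF assms(2)] prod_closed)

text \<open>
  Every generating rule of the congruence other than the relations in R is an instance of an axiom of
  Lie superalgebras, so it holds for the values in L.
\<close>

lemma lterm_value_respects_lcong:
  assumes "(s, t) \<in> lcong K X d R"
    and g: "\<And>x. x \<in> X \<Longrightarrow> g x \<in> homog L (d x)"
    and "\<And>s t. (s, t) \<in> R \<Longrightarrow> lterm_value L g s = lterm_value L g t"
  shows "lterm_value L g s = lterm_value L g t"
  using assms(1)
proof (induction rule: lcong.induct)
  case (relation s t)
  then show ?case by (rule assms(3))
next
  case (Br_skew p s q t)
  then show ?case
    using super_skew[OF lterm_value_homog[OF Br_skew(1) g] lterm_value_homog[OF Br_skew(2) g]]
    by (simp add: lterm_value_Sgn)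
next
  case (Br_alternating t)
  then show ?case
    using even_alternating[OF lterm_value_homog[OF Br_alternating g]] by simp
next
  case (Br_jacobi p s q t r u)
  then show ?case
    using super_jacobi[OF lterm_value_homog[OF Br_jacobi(1) g]
        lterm_value_homog[OF Br_jacobi(2) g] lterm_value_homog[OF Br_jacobi(3) g]]
    by (simp add: lterm_value_Sgn)
next
  case (Add_comm s t)
  then show ?case
    by (simp add: M.a_comm lterm_value_closed[OF _ g])
qed (simp_all add: lterm_value_closed[OF _ g] M.a_assoc M.r_neg smult_l_distr smult_r_distr
    smult_assoc1 prod_add_left prod_add_right prod_smult_left prod_smult_right)

end

locale lie_presentation = cring K
  for K :: "('k, 'r) ring_scheme" (structure) +
  fixes X :: "'x set" and d :: "'x \<Rightarrow> bit" and R :: "(('k, 'x) lterm \<times> ('k, 'x) lterm) set"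
  assumes rels_lterms: "R \<subseteq> lterms K X \<times> lterms K X"
begin

abbreviation P where "P \<equiv> presented_lie K X d R"

definition cls :: "('k, 'x) lterm \<Rightarrow> ('k, 'x) lterm set" where
  "cls t = lcong K X d R `` {t}"

lemma lcong_lterms: "(s, t) \<in> lcong K X d R \<Longrightarrow> s \<in> lterms K X \<and> t \<in> lterms K X"
proof (induction rule: lcong.induct)
  case (relation s t)
  then show ?case using rels_lterms by blast
qed (auto intro!: lterms.intros Sgn_lterms dest: has_deg_lterms)

lemma equiv_lcong: "equiv (lterms K X) (lcong K X d R)"
proof (rule equivI)
  show "lcong K X d R \<subseteq> lterms K X \<times> lterms K X"
    by (auto dest: lcong_lterms)
  show "refl_on (lterms K X) (lcong K X d R)"
    by (rule refl_onI) (rule lcong.refl)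
  show "sym (lcong K X d R)"
    by (rule symI) (rule lcong.sym)
  show "trans (lcong K X d R)"
    by (rule transI) (rule lcong.trans)
qed

lemma cls_eq_iff:
  "\<lbrakk>s \<in> lterms K X; t \<in> lterms K X\<rbrakk> \<Longrightarrow> cls s = cls t \<longleftrightarrow> (s, t) \<in> lcong K X d R"
  unfolding cls_def by (rule eq_equiv_class_iff[OF equiv_lcong])

lemma cls_eqI: "(s, t) \<in> lcong K X d R \<Longrightarrow> cls s = cls t"
  using lcong_lterms cls_eq_iff by blast

lemma mem_cls_iff: "s \<in> cls t \<longleftrightarrow> (t, s) \<in> lcong K X d R"
  by (simp add: cls_def)

lemma carrier_P: "carrier P = cls ` lterms K X"
  by (auto simp: presented_lie_def quotient_def cls_def)

lemma homog_P: "homog P p = cls ` {t. has_deg K X d p t}"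
  by (auto simp: presented_lie_def quotient_def cls_def)

lemma zero_P: "\<zero>\<^bsub>P\<^esub> = cls Zero"
  by (simp add: presented_lie_def cls_def)

lemma self_mem_cls: "t \<in> lterms K X \<Longrightarrow> t \<in> cls t"
  by (simp add: mem_cls_iff lcong.refl)

lemma add_cls:
  assumes "s \<in> lterms K X" "t \<in> lterms K X"
  shows "cls s \<oplus>\<^bsub>P\<^esub> cls t = cls (Add s t)"
proof -
  have "(\<Union>s'\<in>cls s. \<Union>t'\<in>cls t. cls (Add s' t')) = cls (Add s t)"
    using assms
    by (intro UN_eq_const[OF self_mem_cls] cls_eqI lcong.Add_cong)
      (auto simp: mem_cls_iff intro: lcong.sym)
  then show ?thesis by (simp add: presented_lie_def cls_def)
qed

lemma prod_cls:
  assumes "s \<in> lterms K X" "t \<in> lterms K X"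
  shows "cls s \<otimes>\<^bsub>P\<^esub> cls t = cls (Br s t)"
proof -
  have "(\<Union>s'\<in>cls s. \<Union>t'\<in>cls t. cls (Br s' t')) = cls (Br s t)"
    using assms
    by (intro UN_eq_const[OF self_mem_cls] cls_eqI lcong.Br_cong)
      (auto simp: mem_cls_iff intro: lcong.sym)
  then show ?thesis by (simp add: presented_lie_def cls_def)
qed

lemma smult_cls:
  assumes "c \<in> carrier K" "t \<in> lterms K X"
  shows "c \<odot>\<^bsub>P\<^esub> cls t = cls (Smul c t)"
proof -
  have "(\<Union>t'\<in>cls t. cls (Smul c t')) = cls (Smul c t)"
    using assms
    by (intro UN_eq_const[OF self_mem_cls] cls_eqI lcong.Smul_cong)
      (auto simp: mem_cls_iff intro: lcong.sym)
  then show ?thesis by (simp add: presented_lie_def cls_def)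
qed

text \<open>
  The universal property of generators and relations: terms are evaluated in M.
\<close>

lemma presented_lie_hom_exists:
  assumes "lie_superalgebra K M"
    and g: "\<And>x. x \<in> X \<Longrightarrow> g x \<in> homog M (d x)"
    and rels: "\<And>s t. (s, t) \<in> R \<Longrightarrow> lterm_value M g s = lterm_value M g t"
  shows "\<exists>f \<in> lie_hom K P M \<inter> extensional (carrier P). \<forall>x\<in>X. f (cls (Gen x)) = g x"
proof -
  interpret M: lie_superalgebra K M by fact
  define f where "f = restrict (\<lambda>S. lterm_value M g (SOME t. t \<in> S)) (carrier P)"
  have f: "f (cls t) = lterm_value M g t" if "t \<in> lterms K X" for t
  proof -
    have "(SOME t'. t' \<in> cls t) \<in> cls t"
      by (rule someI_ex) (use self_mem_cls[OF that] in blast)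
    then have "lterm_value M g t = lterm_value M g (SOME t'. t' \<in> cls t)"
      using M.lterm_value_respects_lcong[OF _ g rels] by (simp add: mem_cls_iff)
    then show ?thesis
      using that by (simp add: f_def carrier_P)
  qed
  have "f \<in> lie_hom K P M"
    unfolding lie_hom_def
    by (auto simp: carrier_P homog_P f add_cls prod_cls smult_cls lterms.intros has_deg_lterms
        M.lterm_value_closed[OF _ g] M.lterm_value_homog[OF _ g])
  moreover have "f \<in> extensional (carrier P)" by (simp add: f_def)
  moreover have "\<forall>x\<in>X. f (cls (Gen x)) = g x" by (simp add: f lterms.intros)
  ultimately show ?thesis by blast
qed

text \<open>
  Induction on terms.  The values at the classes of \<^const>\<open>Zero\<close> and of negatives are computed from
  \<open>Zero + Zero = Zero\<close> and \<open>t + (- t) = Zero\<close> in the quotient, so that the cancellation takes place in M.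
\<close>

lemma presented_lie_hom_unique:
  assumes "abelian_group M"
    and f: "f \<in> lie_hom K P M" and g: "g \<in> lie_hom K P M"
    and gens: "\<And>x. x \<in> X \<Longrightarrow> f (cls (Gen x)) = g (cls (Gen x))"
    and "y \<in> carrier P"
  shows "f y = g y"
proof -
  interpret M: abelian_group M by fact
  have cls: "cls t \<in> carrier P" if "t \<in> lterms K X" for t
    using that by (simp add: carrier_P)
  have zero: "h (cls Zero) = \<zero>\<^bsub>M\<^esub>" if h: "h \<in> lie_hom K P M" for h
  proof -
    have c: "h (cls Zero) \<in> carrier M"
      using lie_hom_closed[OF h] cls lterms.intros(2) by blast
    have "cls Zero \<oplus>\<^bsub>P\<^esub> cls Zero = cls Zero"
      by (simp add: add_cls lterms.intros cls_eqI lcong.Add_Zero)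
    then have "h (cls Zero) \<oplus>\<^bsub>M\<^esub> h (cls Zero) = h (cls Zero)"
      using lie_hom_add[OF h, of "cls Zero" "cls Zero"] by (simp add: cls lterms.intros)
    then show ?thesis
      using c by simp
  qed
  have neg: "h (cls (Neg t)) = \<ominus>\<^bsub>M\<^esub> h (cls t)"
    if h: "h \<in> lie_hom K P M" and t: "t \<in> lterms K X" for h t
  proof -
    have "cls t \<oplus>\<^bsub>P\<^esub> cls (Neg t) = cls Zero"
      using t by (simp add: add_cls lterms.intros cls_eqI lcong.Add_Neg)
    then have "h (cls t) \<oplus>\<^bsub>M\<^esub> h (cls (Neg t)) = \<zero>\<^bsub>M\<^esub>"
      using lie_hom_add[OF h, of "cls t" "cls (Neg t)"] t zero[OF h]
      by (simp add: cls lterms.intros)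
    then show ?thesis
      using lie_hom_closed[OF h] t
      by (metis M.a_comm M.minus_equality cls lterms.intros(4))
  qed
  obtain t where "t \<in> lterms K X" "y = cls t"
    using assms(5) by (auto simp: carrier_P)
  moreover have "f (cls t) = g (cls t)" if "t \<in> lterms K X" for t
    using that
  proof (induction rule: lterms.induct)
    case (1 x)
    then show ?case by (rule gens)
  next
    case 2
    then show ?case by (simp add: zero f g)
  next
    case (3 s t)
    then show ?case
      by (simp add: add_cls[symmetric] lie_hom_add[OF f] lie_hom_add[OF g] cls)
  next
    case (4 t)
    then show ?case by (simp add: neg f g)
  next
    case (5 c t)
    then show ?case
      by (simp add: smult_cls[symmetric] lie_hom_smult[OF f] lie_hom_smult[OF g] cls)
  next
    case (6 s t)
    then show ?case
      by (simp add: prod_cls[symmetric] lie_hom_prod[OF f] lie_hom_prod[OF g] cls)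
  qed
  ultimately show ?thesis by blast
qed

end

section \<open>Brackets of lifts along a central extension\<close>

lemma lie_hom_zero:
  assumes "super_module K L" "super_module K M" "f \<in> lie_hom K L M"
  shows "f \<zero>\<^bsub>L\<^esub> = \<zero>\<^bsub>M\<^esub>"
proof -
  interpret L: super_module K L by fact
  interpret M: super_module K M by fact
  show ?thesis
    using lie_hom_smult[OF assms(3) L.R.zero_closed L.M.zero_closed]
      lie_hom_closed[OF assms(3) L.M.zero_closed] by simp
qed

lemma lie_hom_neg:
  assumes "super_module K L" "super_module K M" "f \<in> lie_hom K L M" "x \<in> carrier L"
  shows "f (\<ominus>\<^bsub>L\<^esub> x) = \<ominus>\<^bsub>M\<^esub> f x"
proof -
  interpret L: super_module K L by fact
  interpret M: super_module K M by fact
  show ?thesis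
    using lie_hom_smult[OF assms(3) _ assms(4), of "\<ominus>\<^bsub>K\<^esub> \<one>\<^bsub>K\<^esub>"]
      lie_hom_closed[OF assms(3,4)] assms(4)
    by (simp add: L.smult_l_minus M.smult_l_minus)
qed

locale central_lie_extension = M: lie_superalgebra K M + L: lie_superalgebra K L
  for K (structure) and M :: "('k, 'b, 'n) superalgebra_scheme"
    and L :: "('k, 'c, 'm) superalgebra_scheme" +
  fixes \<tau>
  assumes hom: "\<tau> \<in> lie_hom K M L"
    and surj: "\<tau> ` carrier M = carrier L"
    and kernel_central: "a_kernel M L \<tau> \<subseteq> lie_centre M"

lemma central_extension_iff_locale:
  "central_extension K M L \<tau> \<longleftrightarrow> central_lie_extension K M L \<tau>"
  unfolding central_extension_def central_lie_extension_def central_lie_extension_axioms_def ..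

context central_lie_extension
begin

lemmas tau_simps = lie_hom_add[OF hom] lie_hom_smult[OF hom] lie_hom_prod[OF hom]

lemma tau_zero: "\<tau> \<zero>\<^bsub>M\<^esub> = \<zero>\<^bsub>L\<^esub>"
  by (rule lie_hom_zero[OF M.super_module_axioms L.super_module_axioms hom])

lemma tau_neg: "x \<in> carrier M \<Longrightarrow> \<tau> (\<ominus>\<^bsub>M\<^esub> x) = \<ominus>\<^bsub>L\<^esub> \<tau> x"
  by (rule lie_hom_neg[OF M.super_module_axioms L.super_module_axioms hom])

text \<open>
  The part of degree p of any lift is again a lift, by uniqueness of the decomposition in L.
\<close>

lemma homog_lift_exists:
  assumes "x \<in> homog L p"
  shows "\<exists>m \<in> homog M p. \<tau> m = x"
proof -
  have "x \<in> carrier L" by (rule L.homog_carrier[OF assms])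
  then obtain m where m: "m \<in> carrier M" "\<tau> m = x"
    using surj by (metis imageE)
  obtain y z where yz: "y \<in> homog M p" "z \<in> homog M (p + 1)" "m = y \<oplus>\<^bsub>M\<^esub> z"
    by (rule M.homog_parts_exist[OF m(1)])
  have "\<tau> y \<in> homog L p" "\<tau> z \<in> homog L (p + 1)"
    using yz lie_hom_homog[OF hom] by blast+
  moreover have "\<tau> y \<oplus>\<^bsub>L\<^esub> \<tau> z = x \<oplus>\<^bsub>L\<^esub> \<zero>\<^bsub>L\<^esub>"
    using m(2) yz(3) M.homog_carrier[OF yz(1)] M.homog_carrier[OF yz(2)] \<open>x \<in> carrier L\<close>
    by (simp add: tau_simps)
  ultimately have "\<tau> y = x"
    using L.homog_parts_unique(1)[OF _ assms _ L.homog_zero] by blast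
  then show ?thesis using yz(1) by blast
qed

text \<open>
  Two lifts of the same element differ by an element of the kernel, which is central.
\<close>

lemma prod_lifts_left:
  assumes "m \<in> carrier M" "m' \<in> carrier M" "n \<in> carrier M" "\<tau> m = \<tau> m'"
  shows "m \<otimes>\<^bsub>M\<^esub> n = m' \<otimes>\<^bsub>M\<^esub> n"
proof -
  have "\<tau> (m \<oplus>\<^bsub>M\<^esub> \<ominus>\<^bsub>M\<^esub> m') = \<zero>\<^bsub>L\<^esub>"
    using assms lie_hom_closed[OF hom assms(2)] by (simp add: tau_simps tau_neg L.M.r_neg)
  then have "m \<oplus>\<^bsub>M\<^esub> \<ominus>\<^bsub>M\<^esub> m' \<in> a_kernel M L \<tau>"
    using assms by (simp add: a_kernel_def')
  then have "(m \<oplus>\<^bsub>M\<^esub> \<ominus>\<^bsub>M\<^esub> m') \<otimes>\<^bsub>M\<^esub> n = \<zero>\<^bsub>M\<^esub>"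
    using subsetD[OF kernel_central] assms(3) by (simp add: lie_centre_def)
  then have "m \<otimes>\<^bsub>M\<^esub> n \<oplus>\<^bsub>M\<^esub> \<ominus>\<^bsub>M\<^esub> (m' \<otimes>\<^bsub>M\<^esub> n) = \<zero>\<^bsub>M\<^esub>"
    using assms by (simp add: M.prod_add_left M.prod_neg_left)
  then show ?thesis
    using M.M.minus_equality[of "m \<otimes>\<^bsub>M\<^esub> n" "\<ominus>\<^bsub>M\<^esub> (m' \<otimes>\<^bsub>M\<^esub> n)"] assms
    by (simp add: M.prod_closed)
qed

text \<open>
  Since \<^const>\<open>lie_centre\<close> speaks about left multiplication only, the second factor is exchanged by
  means of skew symmetry; this is why all factors are homogeneous.
\<close>

lemma prod_lifts:
  assumes "m \<in> homog M p" "m' \<in> homog M p" "n \<in> homog M q" "n' \<in> homog M q"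
    and "\<tau> m = \<tau> m'" "\<tau> n = \<tau> n'"
  shows "m \<otimes>\<^bsub>M\<^esub> n = m' \<otimes>\<^bsub>M\<^esub> n'"
proof -
  note carr = assms(1-4)[THEN M.homog_carrier]
  have "m \<otimes>\<^bsub>M\<^esub> n = m' \<otimes>\<^bsub>M\<^esub> n"
    by (rule prod_lifts_left) (use carr assms in auto)
  also have "\<dots> = \<ominus>\<^bsub>M\<^esub> koszul_sign M (p * q) (n \<otimes>\<^bsub>M\<^esub> m')"
    by (rule M.super_skew[OF assms(2,3)])
  also have "n \<otimes>\<^bsub>M\<^esub> m' = n' \<otimes>\<^bsub>M\<^esub> m'"
    by (rule prod_lifts_left) (use carr assms in auto)
  also have "\<ominus>\<^bsub>M\<^esub> koszul_sign M (p * q) (n' \<otimes>\<^bsub>M\<^esub> m') = m' \<otimes>\<^bsub>M\<^esub> n'"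
    by (rule M.super_skew[OF assms(2,4), symmetric])
  finally show ?thesis .
qed

text \<open>
  The element H acts as a derivation, and in each of the two resulting terms the inner bracket
  \<open>[H, m]\<close> or \<open>[H, n]\<close> may be replaced by \<open>c m\<close> or \<open>d n\<close>, which has the same image in L.
\<close>

lemma prod_lifts_weight:
  assumes H: "H \<in> homog M 0" and m: "m \<in> homog M p" and n: "n \<in> homog M q"
    and c: "c \<in> carrier K" "\<tau> H \<otimes>\<^bsub>L\<^esub> \<tau> m = c \<odot>\<^bsub>L\<^esub> \<tau> m"
    and d: "d \<in> carrier K" "\<tau> H \<otimes>\<^bsub>L\<^esub> \<tau> n = d \<odot>\<^bsub>L\<^esub> \<tau> n"
  shows "H \<otimes>\<^bsub>M\<^esub> (m \<otimes>\<^bsub>M\<^esub> n) = (c \<oplus> d) \<odot>\<^bsub>M\<^esub> (m \<otimes>\<^bsub>M\<^esub> n)"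
proof -
  note carr = H[THEN M.homog_carrier] m[THEN M.homog_carrier] n[THEN M.homog_carrier]
  have "H \<otimes>\<^bsub>M\<^esub> m \<in> homog M p" "H \<otimes>\<^bsub>M\<^esub> n \<in> homog M q"
    using M.prod_even[OF H m] M.prod_even[OF H n] by (simp_all only: add_0)
  note Hmn = this
  have "(H \<otimes>\<^bsub>M\<^esub> m) \<otimes>\<^bsub>M\<^esub> n = (c \<odot>\<^bsub>M\<^esub> m) \<otimes>\<^bsub>M\<^esub> n"
    using Hmn carr c
    by (intro prod_lifts[of _ p _ _ q]) (simp_all add: tau_simps M.homog_smult m n)
  moreover have "m \<otimes>\<^bsub>M\<^esub> (H \<otimes>\<^bsub>M\<^esub> n) = m \<otimes>\<^bsub>M\<^esub> (d \<odot>\<^bsub>M\<^esub> n)"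
    using Hmn carr d
    by (intro prod_lifts[of _ p _ _ q]) (simp_all add: tau_simps M.homog_smult m n)
  ultimately show ?thesis
    using carr c d
    by (simp add: M.even_derivation[OF H m n] M.prod_smult_left M.prod_smult_right
        M.smult_l_distr M.prod_closed)
qed

text \<open>
  A bracket of unit weight is determined by its image in L: the bracket of H with it depends only on
  that image, and on the other hand equals an invertible multiple of it.
\<close>

lemma prod_lifts_eq_if_unit_weight:
  assumes H: "H \<in> homog M 0"
    and hom: "m \<in> homog M p" "n \<in> homog M q" "m' \<in> homog M p'" "n' \<in> homog M q'" "p + q = p' + q'"
    and weights: "c \<in> carrier K" "d \<in> carrier K" "c' \<in> carrier K" "d' \<in> carrier K"
      "\<tau> H \<otimes>\<^bsub>L\<^esub> \<tau> m = c \<odot>\<^bsub>L\<^esub> \<tau> m" "\<tau> H \<otimes>\<^bsub>L\<^esub> \<tau> n = d \<odot>\<^bsub>L\<^esub> \<tau> n"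
      "\<tau> H \<otimes>\<^bsub>L\<^esub> \<tau> m' = c' \<odot>\<^bsub>L\<^esub> \<tau> m'" "\<tau> H \<otimes>\<^bsub>L\<^esub> \<tau> n' = d' \<odot>\<^bsub>L\<^esub> \<tau> n'"
    and unit: "c \<oplus> d = c' \<oplus> d'" "(c \<oplus> d) \<otimes> (c \<oplus> d) = \<one>"
    and eq: "\<tau> m \<otimes>\<^bsub>L\<^esub> \<tau> n = \<tau> m' \<otimes>\<^bsub>L\<^esub> \<tau> n'"
  shows "m \<otimes>\<^bsub>M\<^esub> n = m' \<otimes>\<^bsub>M\<^esub> n'"
proof -
  note carr = hom(1-4)[THEN M.homog_carrier]
  have prods: "m \<otimes>\<^bsub>M\<^esub> n \<in> homog M (p + q)" "m' \<otimes>\<^bsub>M\<^esub> n' \<in> homog M (p + q)"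
    using M.prod_even[OF hom(1,2)] M.prod_even[OF hom(3,4)] by (simp_all only: hom(5))
  then have "H \<otimes>\<^bsub>M\<^esub> (m \<otimes>\<^bsub>M\<^esub> n) = H \<otimes>\<^bsub>M\<^esub> (m' \<otimes>\<^bsub>M\<^esub> n')"
    using carr eq by (intro prod_lifts[OF H H]) (simp_all add: tau_simps)
  then have eq': "(c \<oplus> d) \<odot>\<^bsub>M\<^esub> (m \<otimes>\<^bsub>M\<^esub> n) = (c \<oplus> d) \<odot>\<^bsub>M\<^esub> (m' \<otimes>\<^bsub>M\<^esub> n')"
    using prod_lifts_weight[OF H hom(1,2) weights(1,5,2,6)]
      prod_lifts_weight[OF H hom(3,4) weights(3,7,4,8)] unit(1) by simp
  have undo: "(c \<oplus> d) \<odot>\<^bsub>M\<^esub> ((c \<oplus> d) \<odot>\<^bsub>M\<^esub> y) = y" if "y \<in> carrier M" for y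
    using that unit(2) weights(1,2) by (simp add: M.smult_assoc1[symmetric])
  show ?thesis
    using arg_cong[OF eq', of "\<lambda>y. (c \<oplus> d) \<odot>\<^bsub>M\<^esub> y"] undo prods[THEN M.homog_carrier]
    by simp
qed

end

section \<open>Weights of the Steinberg generators\<close>

text \<open>
  A family of elements subject to the defining relations of \<open>st(2,1,A)\<close>.  By the universal property it
  amounts to a homomorphism from \<open>st(2,1,A)\<close> to L; the notion applies both to the generators themselves
  and to their images under a section.
\<close>

locale steinberg_family = L: lie_superalgebra K L + A: assoc_superalgebra K A
  for K :: "('k, 'r) ring_scheme" (structure) and L :: "('k, 'b, 'n) superalgebra_scheme"
    and A :: "('k, 'a, 'm) superalgebra_scheme" +
  fixes F :: "nat \<Rightarrow> nat \<Rightarrow> bit \<Rightarrow> 'a \<Rightarrow> 'b"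
  assumes F_homog: "\<lbrakk>i \<in> {1..3}; j \<in> {1..3}; i \<noteq> j; a \<in> homog A p\<rbrakk> \<Longrightarrow>
      F i j p a \<in> homog L (index_deg i + index_deg j + p)"
    and F_add: "\<lbrakk>i \<in> {1..3}; j \<in> {1..3}; i \<noteq> j; a \<in> homog A p; b \<in> homog A p\<rbrakk> \<Longrightarrow>
      F i j p (a \<oplus>\<^bsub>A\<^esub> b) = F i j p a \<oplus>\<^bsub>L\<^esub> F i j p b"
    and F_smult: "\<lbrakk>i \<in> {1..3}; j \<in> {1..3}; i \<noteq> j; c \<in> carrier K; a \<in> homog A p\<rbrakk> \<Longrightarrow>
      F i j p (c \<odot>\<^bsub>A\<^esub> a) = c \<odot>\<^bsub>L\<^esub> F i j p a"
    and F_prod: "\<lbrakk>i \<in> {1..3}; j \<in> {1..3}; k \<in> {1..3}; distinct [i, j, k];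
        a \<in> homog A p; b \<in> homog A q\<rbrakk> \<Longrightarrow>
      F i j p a \<otimes>\<^bsub>L\<^esub> F j k q b = F i k (p + q) (a \<otimes>\<^bsub>A\<^esub> b)"
    and F_prod_zero: "\<lbrakk>i \<in> {1..3}; j \<in> {1..3}; k \<in> {1..3}; l \<in> {1..3}; i \<noteq> j; k \<noteq> l;
        j \<noteq> k; i \<noteq> l; a \<in> homog A p; b \<in> homog A q\<rbrakk> \<Longrightarrow>
      F i j p a \<otimes>\<^bsub>L\<^esub> F k l q b = \<zero>\<^bsub>L\<^esub>"
begin

lemma one_right: "a \<in> homog A p \<Longrightarrow> a \<otimes>\<^bsub>A\<^esub> \<one>\<^bsub>A\<^esub> = a"
  and one_left: "a \<in> homog A p \<Longrightarrow> \<one>\<^bsub>A\<^esub> \<otimes>\<^bsub>A\<^esub> a = a"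
  by (simp_all add: A.homog_carrier)

lemma F_carrier:
  "\<lbrakk>i \<in> {1..3}; j \<in> {1..3}; i \<noteq> j; a \<in> homog A p\<rbrakk> \<Longrightarrow> F i j p a \<in> carrier L"
  by (rule L.homog_carrier[OF F_homog])

lemma F_factor:
  assumes "i \<in> {1..3}" "j \<in> {1..3}" "k \<in> {1..3}" "distinct [i, j, k]" "a \<in> homog A p"
  shows "F i j p a \<otimes>\<^bsub>L\<^esub> F j k 0 \<one>\<^bsub>A\<^esub> = F i k p a" "F i j 0 \<one>\<^bsub>A\<^esub> \<otimes>\<^bsub>L\<^esub> F j k p a = F i k p a"
  using F_prod[OF assms(1-5) A.one_even] F_prod[OF assms(1-4) A.one_even assms(5)]
    one_right[OF assms(5)] one_left[OF assms(5)]
  by (simp_all only: add_0 add_0_right)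

text \<open>
  The index \<open>3 - t\<close> is the even index other than t.
\<close>

definition weight_elem :: "nat \<Rightarrow> 'b" where
  "weight_elem t = F (3 - t) 3 0 \<one>\<^bsub>A\<^esub> \<otimes>\<^bsub>L\<^esub> F 3 (3 - t) 0 \<one>\<^bsub>A\<^esub>"

text \<open>
  The weight of the matrix unit \<open>e\<^sub>i\<^sub>j\<close> under the bracket with \<open>- e\<^sub>t\<^sub>t\<close>.
\<close>

definition weight :: "nat \<Rightarrow> nat \<Rightarrow> nat \<Rightarrow> 'k" where
  "weight t i j = (if j = t then \<one> else \<zero>) \<oplus> \<ominus> (if i = t then \<one> else \<zero>)"

lemma weight_closed [simp]: "weight t i j \<in> carrier K"
  by (simp add: weight_def)

lemma weight_elem_even:
  assumes "t \<in> {1, 2}"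
  shows "weight_elem t \<in> homog L 0"
proof -
  have "F (3 - t) 3 0 \<one>\<^bsub>A\<^esub> \<in> homog L 1" "F 3 (3 - t) 0 \<one>\<^bsub>A\<^esub> \<in> homog L 1"
    using F_homog[of "3 - t" 3 "\<one>\<^bsub>A\<^esub>" 0] F_homog[of 3 "3 - t" "\<one>\<^bsub>A\<^esub>" 0] assms A.one_even
    by (auto simp: index_deg_def)
  then show ?thesis
    using L.prod_even[of _ 1 _ 1] by (auto simp: weight_elem_def)
qed

text \<open>
  On the four root vectors that involve t and one further index the formula results from letting the
  two odd factors of \<open>h\<^sub>t\<close> act one after the other.  The remaining two, \<open>F\<^sub>s\<^sub>3(a)\<close> and \<open>F\<^sub>3\<^sub>s(a)\<close>, are
  brackets of those of weights 1 and -1, and the weights add up to 0.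
\<close>

lemma weight_elem_prod:
  assumes t: "t \<in> {1, 2}" and ij: "i \<in> {1..3}" "j \<in> {1..3}" "i \<noteq> j" and a: "a \<in> homog A p"
  shows "weight_elem t \<otimes>\<^bsub>L\<^esub> F i j p a = weight t i j \<odot>\<^bsub>L\<^esub> F i j p a"
proof -
  define s where "s = 3 - t"
  have st: "s \<in> {1..3}" "t \<in> {1..3}" "s \<noteq> t" "s \<noteq> 3" "t \<noteq> 3" "3 \<in> {1..3::nat}"
    "t \<noteq> s" "3 \<noteq> s" "3 \<noteq> t"
    using t by (auto simp: s_def)
  have deg: "index_deg s = 0" "index_deg t = 0" "index_deg 3 = 1"
    using st by (simp_all add: index_deg_def)
  define x y where "x = F s 3 0 \<one>\<^bsub>A\<^esub>" and "y = F 3 s 0 \<one>\<^bsub>A\<^esub>"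
  have odd: "x \<in> homog L 1" "y \<in> homog L 1"
    using F_homog[OF st(1,6,4) A.one_even] F_homog[OF st(6,1,8) A.one_even]
    by (simp_all add: x_def y_def deg)
  have carr: "x \<in> carrier L" "y \<in> carrier L"
    using odd L.homog_carrier by blast+
  have h: "weight_elem t = x \<otimes>\<^bsub>L\<^esub> y"
    by (simp add: weight_elem_def x_def y_def s_def)
  have act: "weight_elem t \<otimes>\<^bsub>L\<^esub> z = x \<otimes>\<^bsub>L\<^esub> (y \<otimes>\<^bsub>L\<^esub> z) \<oplus>\<^bsub>L\<^esub> y \<otimes>\<^bsub>L\<^esub> (x \<otimes>\<^bsub>L\<^esub> z)"
    if "z \<in> homog L r" for z r
    unfolding h by (rule L.odd_prod_action[OF odd that])
  have wst: "weight_elem t \<otimes>\<^bsub>L\<^esub> F s t r b = F s t r b"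
    and w3t: "weight_elem t \<otimes>\<^bsub>L\<^esub> F 3 t r b = F 3 t r b"
    if b: "b \<in> homog A r" for b r
  proof -
    have z: "x \<otimes>\<^bsub>L\<^esub> F s t r b = \<zero>\<^bsub>L\<^esub>" "y \<otimes>\<^bsub>L\<^esub> F 3 t r b = \<zero>\<^bsub>L\<^esub>"
      unfolding x_def y_def using st A.one_even b by (auto intro!: F_prod_zero)
    have f: "y \<otimes>\<^bsub>L\<^esub> F s t r b = F 3 t r b" "x \<otimes>\<^bsub>L\<^esub> F 3 t r b = F s t r b"
      unfolding x_def y_def using st b by (auto intro!: F_factor)
    have c: "F s t r b \<in> carrier L" "F 3 t r b \<in> carrier L"
      using st b by (auto intro!: F_carrier)
    show "weight_elem t \<otimes>\<^bsub>L\<^esub> F s t r b = F s t r b"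
      using c carr by (simp add: act[OF F_homog[OF st(1-3) b]] z f)
    show "weight_elem t \<otimes>\<^bsub>L\<^esub> F 3 t r b = F 3 t r b"
      using c carr by (simp add: act[OF F_homog[OF st(6,2,9) b]] z f)
  qed
  have wts: "weight_elem t \<otimes>\<^bsub>L\<^esub> F t s r b = \<ominus>\<^bsub>L\<^esub> F t s r b"
    and wt3: "weight_elem t \<otimes>\<^bsub>L\<^esub> F t 3 r b = \<ominus>\<^bsub>L\<^esub> F t 3 r b"
    if b: "b \<in> homog A r" for b r
  proof -
    have hom: "F t s r b \<in> homog L r" "F t 3 r b \<in> homog L (1 + r)"
      using F_homog[OF st(2,1,7) b] F_homog[OF st(2,6,5) b] by (simp_all only: deg add_0)
    have c: "F t s r b \<in> carrier L" "F t 3 r b \<in> carrier L"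
      using hom L.homog_carrier by blast+
    have z: "y \<otimes>\<^bsub>L\<^esub> F t s r b = \<zero>\<^bsub>L\<^esub>" "x \<otimes>\<^bsub>L\<^esub> F t 3 r b = \<zero>\<^bsub>L\<^esub>"
      unfolding x_def y_def using st A.one_even b by (auto intro!: F_prod_zero)
    have f: "F t s r b \<otimes>\<^bsub>L\<^esub> x = F t 3 r b" "F t 3 r b \<otimes>\<^bsub>L\<^esub> y = F t s r b"
      unfolding x_def y_def using st b by (auto intro!: F_factor)
    have sk: "x \<otimes>\<^bsub>L\<^esub> F t s r b = \<ominus>\<^bsub>L\<^esub> koszul_sign L r (F t 3 r b)"
      "y \<otimes>\<^bsub>L\<^esub> F t 3 r b = \<ominus>\<^bsub>L\<^esub> koszul_sign L (1 + r) (F t s r b)"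
      using L.super_skew[OF odd(1) hom(1)] L.super_skew[OF odd(2) hom(2)] f
      by (simp_all only: mult_1)
    have k: "koszul_sign L r (koszul_sign L (1 + r) z) = \<ominus>\<^bsub>L\<^esub> z"
      "koszul_sign L (1 + r) (koszul_sign L r z) = \<ominus>\<^bsub>L\<^esub> z" for z
      by (cases r; simp add: koszul_sign_def)+
    have "weight_elem t \<otimes>\<^bsub>L\<^esub> F t s r b = y \<otimes>\<^bsub>L\<^esub> (x \<otimes>\<^bsub>L\<^esub> F t s r b)"
      using c carr by (simp add: act[OF hom(1)] z L.prod_closed)
    also have "\<dots> = \<ominus>\<^bsub>L\<^esub> koszul_sign L r (y \<otimes>\<^bsub>L\<^esub> F t 3 r b)"
      unfolding sk(1) using c carr by (simp add: L.prod_neg_right L.prod_koszul_sign_right)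
    also have "\<dots> = \<ominus>\<^bsub>L\<^esub> F t s r b"
      unfolding sk(2) using c by (simp only: k L.koszul_sign_neg L.koszul_sign_closed
          L.M.minus_minus L.M.a_inv_closed)
    finally show "weight_elem t \<otimes>\<^bsub>L\<^esub> F t s r b = \<ominus>\<^bsub>L\<^esub> F t s r b" .
    have "weight_elem t \<otimes>\<^bsub>L\<^esub> F t 3 r b = x \<otimes>\<^bsub>L\<^esub> (y \<otimes>\<^bsub>L\<^esub> F t 3 r b)"
      using c carr by (simp add: act[OF hom(2)] z L.prod_closed)
    also have "\<dots> = \<ominus>\<^bsub>L\<^esub> koszul_sign L (1 + r) (x \<otimes>\<^bsub>L\<^esub> F t s r b)"
      unfolding sk(2) using c carr by (simp only: L.prod_neg_right L.prod_koszul_sign_right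
          L.koszul_sign_closed)
    also have "\<dots> = \<ominus>\<^bsub>L\<^esub> F t 3 r b"
      unfolding sk(1) using c by (simp only: k L.koszul_sign_neg L.koszul_sign_closed
          L.M.minus_minus L.M.a_inv_closed)
    finally show "weight_elem t \<otimes>\<^bsub>L\<^esub> F t 3 r b = \<ominus>\<^bsub>L\<^esub> F t 3 r b" .
  qed
  have ws3: "weight_elem t \<otimes>\<^bsub>L\<^esub> F s 3 r b = \<zero>\<^bsub>L\<^esub>"
    and w3s: "weight_elem t \<otimes>\<^bsub>L\<^esub> F 3 s r b = \<zero>\<^bsub>L\<^esub>"
    if b: "b \<in> homog A r" for b r
  proof -
    have f: "F s t r b \<otimes>\<^bsub>L\<^esub> F t 3 0 \<one>\<^bsub>A\<^esub> = F s 3 r b" "F 3 t r b \<otimes>\<^bsub>L\<^esub> F t s 0 \<one>\<^bsub>A\<^esub> = F 3 s r b"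
      using st b by (auto intro!: F_factor)
    have c: "F s t r b \<in> carrier L" "F 3 t r b \<in> carrier L" "F t 3 0 \<one>\<^bsub>A\<^esub> \<in> carrier L"
      "F t s 0 \<one>\<^bsub>A\<^esub> \<in> carrier L" "F s 3 r b \<in> carrier L" "F 3 s r b \<in> carrier L"
      using st b A.one_even by (auto intro!: F_carrier)
    have "weight_elem t \<otimes>\<^bsub>L\<^esub> (F s t r b \<otimes>\<^bsub>L\<^esub> F t 3 0 \<one>\<^bsub>A\<^esub>) = F s 3 r b \<oplus>\<^bsub>L\<^esub> \<ominus>\<^bsub>L\<^esub> F s 3 r b"
      unfolding L.even_derivation[OF weight_elem_even[OF t] F_homog[OF st(1-3) b]
          F_homog[OF st(2,6,5) A.one_even]]
      using c by (simp add: wst[OF b] wt3[OF A.one_even] f L.prod_neg_right)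
    then show "weight_elem t \<otimes>\<^bsub>L\<^esub> F s 3 r b = \<zero>\<^bsub>L\<^esub>"
      using c by (simp add: f L.M.r_neg)
    have "weight_elem t \<otimes>\<^bsub>L\<^esub> (F 3 t r b \<otimes>\<^bsub>L\<^esub> F t s 0 \<one>\<^bsub>A\<^esub>) = F 3 s r b \<oplus>\<^bsub>L\<^esub> \<ominus>\<^bsub>L\<^esub> F 3 s r b"
      unfolding L.even_derivation[OF weight_elem_even[OF t] F_homog[OF st(6,2,9) b]
          F_homog[OF st(2,1,7) A.one_even]]
      using c by (simp add: w3t[OF b] wts[OF A.one_even] f L.prod_neg_right)
    then show "weight_elem t \<otimes>\<^bsub>L\<^esub> F 3 s r b = \<zero>\<^bsub>L\<^esub>"
      using c by (simp add: f L.M.r_neg)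
  qed
  have carrF: "F i j p a \<in> carrier L"
    by (rule F_carrier[OF ij a])
  have "i \<in> {s, t, 3}" "j \<in> {s, t, 3}"
    using ij t by (auto simp: s_def)
  then consider "i = s" "j = t" | "i = 3" "j = t" | "i = t" "j = s" | "i = t" "j = 3"
    | "i = s" "j = 3" | "i = 3" "j = s"
    using ij(3) by blast
  then show ?thesis
    using carrF st
    by cases (simp_all add: weight_def wst[OF a] w3t[OF a] wts[OF a] wt3[OF a] ws3[OF a] w3s[OF a]
        L.smult_minus_one)
qed

end

section \<open>Lifting the Steinberg relations\<close>

lemma middle_degree_cancels: "x + k + p + (k + y + q) = x + y + (p + q)" for x y k p q :: bit
  by (cases x; cases y; cases k; cases p; cases q) simp_all

lemma third_index:
  assumes "i \<in> {1..3}" "j \<in> {1..3}" "i \<noteq> j"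
  shows "6 - i - j \<in> {1..3::nat}" "distinct [i, 6 - i - j, j]" "i \<noteq> 6 - i - j" "6 - i - j \<noteq> j"
proof -
  have "i = 1 \<or> i = 2 \<or> i = 3" "j = 1 \<or> j = 2 \<or> j = 3"
    using assms by auto
  with assms(3) show "6 - i - j \<in> {1..3}" "distinct [i, 6 - i - j, j]" "i \<noteq> 6 - i - j" "6 - i - j \<noteq> j"
    by auto
qed

locale steinberg_central_extension =
  steinberg_family K L A F + central_lie_extension K M L \<tau>
  for K :: "('k, 'r) ring_scheme" (structure) and L :: "('k, 'c, 'l) superalgebra_scheme"
    and A :: "('k, 'a, 'm) superalgebra_scheme" and F
    and M :: "('k, 'b, 'n) superalgebra_scheme" and \<tau>
begin

text \<open>
  The degree is part of the notion because brackets are compared for lifts of equal degree.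
\<close>

definition is_lift :: "nat \<Rightarrow> nat \<Rightarrow> bit \<Rightarrow> 'a \<Rightarrow> 'b \<Rightarrow> bool" where
  "is_lift i j p a m \<longleftrightarrow> m \<in> homog M (index_deg i + index_deg j + p) \<and> \<tau> m = F i j p a"

lemma is_lift_exists:
  assumes "i \<in> {1..3}" "j \<in> {1..3}" "i \<noteq> j" "a \<in> homog A p"
  shows "\<exists>m. is_lift i j p a m"
  using homog_lift_exists[OF F_homog[OF assms]] by (auto simp: is_lift_def)

lemma is_lift_carrier: "is_lift i j p a m \<Longrightarrow> m \<in> carrier M"
  by (auto simp: is_lift_def M.homog_carrier)

lemma is_lift_weight:
  assumes "t \<in> {1, 2}" "i \<in> {1..3}" "j \<in> {1..3}" "i \<noteq> j" "a \<in> homog A p"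
    and "is_lift i j p a m" "\<tau> H = weight_elem t"
  shows "\<tau> H \<otimes>\<^bsub>L\<^esub> \<tau> m = weight t i j \<odot>\<^bsub>L\<^esub> \<tau> m"
  using weight_elem_prod[OF assms(1-5)] assms(6,7) by (simp add: is_lift_def)

text \<open>
  The bracket is compared with that of zero and zero, where zero counts as a vector of any weight.
\<close>

lemma lifts_prod_zero_unit_weight:
  assumes t: "t \<in> {1, 2}" and ij: "i \<in> {1..3}" "j \<in> {1..3}" "i \<noteq> j" "a \<in> homog A p"
    and kl: "k \<in> {1..3}" "l \<in> {1..3}" "k \<noteq> l" "b \<in> homog A q"
    and m: "is_lift i j p a m" and n: "is_lift k l q b n"
    and zero: "F i j p a \<otimes>\<^bsub>L\<^esub> F k l q b = \<zero>\<^bsub>L\<^esub>"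
    and unit: "(weight t i j \<oplus> weight t k l) \<otimes> (weight t i j \<oplus> weight t k l) = \<one>"
  shows "m \<otimes>\<^bsub>M\<^esub> n = \<zero>\<^bsub>M\<^esub>"
proof -
  obtain H where H: "H \<in> homog M 0" "\<tau> H = weight_elem t"
    using homog_lift_exists[OF weight_elem_even[OF t]] by blast
  have tauH: "\<tau> H \<in> carrier L"
    using H weight_elem_even[OF t] L.homog_carrier by simp
  have "m \<otimes>\<^bsub>M\<^esub> n = \<zero>\<^bsub>M\<^esub> \<otimes>\<^bsub>M\<^esub> \<zero>\<^bsub>M\<^esub>"
  proof (rule prod_lifts_eq_if_unit_weight[OF H(1) _ _ _ _ HOL.refl])
    show "m \<in> homog M (index_deg i + index_deg j + p)" "n \<in> homog M (index_deg k + index_deg l + q)"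
      using m n by (simp_all add: is_lift_def)
    show "\<tau> H \<otimes>\<^bsub>L\<^esub> \<tau> m = weight t i j \<odot>\<^bsub>L\<^esub> \<tau> m"
      by (rule is_lift_weight[OF t ij m H(2)])
    show "\<tau> H \<otimes>\<^bsub>L\<^esub> \<tau> n = weight t k l \<odot>\<^bsub>L\<^esub> \<tau> n"
      by (rule is_lift_weight[OF t kl n H(2)])
    show "\<tau> H \<otimes>\<^bsub>L\<^esub> \<tau> \<zero>\<^bsub>M\<^esub> = weight t i j \<odot>\<^bsub>L\<^esub> \<tau> \<zero>\<^bsub>M\<^esub>" "\<tau> H \<otimes>\<^bsub>L\<^esub> \<tau> \<zero>\<^bsub>M\<^esub> = weight t k l \<odot>\<^bsub>L\<^esub> \<tau> \<zero>\<^bsub>M\<^esub>"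
      using tauH by (simp_all add: tau_zero)
    show "\<tau> m \<otimes>\<^bsub>L\<^esub> \<tau> n = \<tau> \<zero>\<^bsub>M\<^esub> \<otimes>\<^bsub>L\<^esub> \<tau> \<zero>\<^bsub>M\<^esub>"
      using m n zero by (simp add: is_lift_def tau_zero)
  qed (simp_all add: unit)
  then show ?thesis by simp
qed

text \<open>
  The vanishing relations in M.  With three indices there are three cases: equal rows, equal columns,
  or both.  In the first case the total weight is \<open>\<delta>\<^sub>j\<^sub>t + \<delta>\<^sub>l\<^sub>t\<close> for \<open>t \<noteq> i\<close>, and in the second it is
  \<open>- \<delta>\<^sub>i\<^sub>t - \<delta>\<^sub>k\<^sub>t\<close> for \<open>t \<noteq> j\<close>; one of the two distinct indices in question is not 3 and serves as t.
  In the third case all weights are even, but \<open>F\<^sub>i\<^sub>j(a)\<close> is the bracket of \<open>F\<^sub>i\<^sub>r(a)\<close> and \<open>F\<^sub>r\<^sub>j(1)\<close>, whose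
  brackets with \<open>F\<^sub>i\<^sub>j(b)\<close> are zero.
\<close>

lemma lifts_prod_zero:
  assumes ij: "i \<in> {1..3}" "j \<in> {1..3}" "i \<noteq> j" "a \<in> homog A p"
    and kl: "k \<in> {1..3}" "l \<in> {1..3}" "k \<noteq> l" "b \<in> homog A q"
    and ne: "j \<noteq> k" "i \<noteq> l"
    and m: "is_lift i j p a m" and n: "is_lift k l q b n"
  shows "m \<otimes>\<^bsub>M\<^esub> n = \<zero>\<^bsub>M\<^esub>"
proof -
  have zero: "F i j p a \<otimes>\<^bsub>L\<^esub> F k l q b = \<zero>\<^bsub>L\<^esub>"
    by (rule F_prod_zero[OF ij(1,2) kl(1,2) ij(3) kl(3) ne ij(4) kl(4)])
  note by_weight = lifts_prod_zero_unit_weight[OF _ ij kl m n zero]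
  consider "i = k" "j \<noteq> l" | "i \<noteq> k" "j = l" | "i = k" "j = l"
    using ij kl ne by fastforce
  then show ?thesis
  proof cases
    case 1
    define t where "t = (if j = 3 then l else j)"
    have "t \<in> {1, 2}" "t \<noteq> i" "t = j \<and> t \<noteq> l \<or> t = l \<and> t \<noteq> j"
      using 1 ij kl by (auto simp: t_def)
    then show ?thesis
      using 1 by (intro by_weight[of t]) (auto simp: weight_def)
  next
    case 2
    define t where "t = (if i = 3 then k else i)"
    have "t \<in> {1, 2}" "t \<noteq> j" "t = i \<and> t \<noteq> k \<or> t = k \<and> t \<noteq> i"
      using 2 ij kl by (auto simp: t_def)
    then show ?thesis
      using 2 by (intro by_weight[of t]) (auto simp: weight_def L.R.l_minus L.R.r_minus)
  next
    case 3
    define r where "r = 6 - i - j"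
    have r: "r \<in> {1..3}" "distinct [i, r, j]" "i \<noteq> r" "r \<noteq> j"
      unfolding r_def by (rule third_index[OF ij(1-3)])+
    obtain u v where u: "is_lift i r p a u" and v: "is_lift r j 0 \<one>\<^bsub>A\<^esub> v"
      using is_lift_exists[OF ij(1) r(1,3) ij(4)] is_lift_exists[OF r(1) ij(2) r(4) A.one_even]
      by blast
    have hom: "u \<in> homog M (index_deg i + index_deg r + p)"
      "v \<in> homog M (index_deg r + index_deg j + 0)" "n \<in> homog M (index_deg k + index_deg l + q)"
      "m \<in> homog M (index_deg i + index_deg j + p)"
      using u v n m by (simp_all only: is_lift_def)
    note carr = hom(1-3)[THEN M.homog_carrier]
    (* The brackets of v and u with n lie in the kernel, hence a further bracket kills them. *)
    have "\<tau> (v \<otimes>\<^bsub>M\<^esub> n) = \<tau> \<zero>\<^bsub>M\<^esub>" "\<tau> (u \<otimes>\<^bsub>M\<^esub> n) = \<tau> \<zero>\<^bsub>M\<^esub>"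
      using u v n carr 3 r ij kl A.one_even
      by (auto simp: tau_simps is_lift_def tau_zero intro!: F_prod_zero)
    then have z: "u \<otimes>\<^bsub>M\<^esub> (v \<otimes>\<^bsub>M\<^esub> n) = \<zero>\<^bsub>M\<^esub>" "v \<otimes>\<^bsub>M\<^esub> (u \<otimes>\<^bsub>M\<^esub> n) = \<zero>\<^bsub>M\<^esub>"
      using prod_lifts[OF hom(1,1) M.prod_even[OF hom(2,3)] M.homog_zero]
        prod_lifts[OF hom(2,2) M.prod_even[OF hom(1,3)] M.homog_zero] carr
      by simp_all
    have uvn: "(u \<otimes>\<^bsub>M\<^esub> v) \<otimes>\<^bsub>M\<^esub> n = \<zero>\<^bsub>M\<^esub>"
      using M.super_leibniz[OF hom(1-3)] z carr
      by (simp add: M.prod_closed)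
    have "\<tau> m = \<tau> (u \<otimes>\<^bsub>M\<^esub> v)"
      using m u v carr F_factor(1)[OF ij(1) r(1) ij(2) r(2) ij(4)]
      by (simp add: is_lift_def tau_simps)
    then have "m \<otimes>\<^bsub>M\<^esub> n = (u \<otimes>\<^bsub>M\<^esub> v) \<otimes>\<^bsub>M\<^esub> n"
      by (intro prod_lifts_left M.prod_closed carr M.homog_carrier[OF hom(4)])
    then show ?thesis by (simp only: uvn)
  qed
qed

text \<open>
  Both sides are lifts of \<open>F\<^sub>i\<^sub>k(ab)\<close> and have the weight \<open>\<delta>\<^sub>k\<^sub>t - \<delta>\<^sub>i\<^sub>t\<close>, which is \<open>\<plusminus>1\<close> if t is i or k.
\<close>

lemma lifts_prod_move:
  assumes ijk: "i \<in> {1..3}" "j \<in> {1..3}" "k \<in> {1..3}" "distinct [i, j, k]"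
    and ab: "a \<in> homog A p" "b \<in> homog A q"
    and m: "is_lift i j p a m" and n: "is_lift j k q b n"
    and m': "is_lift i j (p + q) (a \<otimes>\<^bsub>A\<^esub> b) m'" and n': "is_lift j k 0 \<one>\<^bsub>A\<^esub> n'"
  shows "m \<otimes>\<^bsub>M\<^esub> n = m' \<otimes>\<^bsub>M\<^esub> n'"
proof -
  define t where "t = (if i = 3 then k else i)"
  have t: "t \<in> {1, 2}" "t \<noteq> j" "t = i \<and> t \<noteq> k \<or> t = k \<and> t \<noteq> i"
    using ijk by (auto simp: t_def)
  have ne: "i \<noteq> j" "j \<noteq> k" using ijk by auto
  obtain H where H: "H \<in> homog M 0" "\<tau> H = weight_elem t"
    using homog_lift_exists[OF weight_elem_even[OF t(1)]] by blast
  have prod: "a \<otimes>\<^bsub>A\<^esub> b \<in> homog A (p + q)"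
    by (rule A.prod_even[OF ab])
  note wij = is_lift_weight[OF t(1) ijk(1,2) ne(1) _ _ H(2)]
    and wjk = is_lift_weight[OF t(1) ijk(2,3) ne(2) _ _ H(2)]
  show ?thesis
  proof (rule prod_lifts_eq_if_unit_weight[OF H(1) _ _ _ _ _ _ _ _ _ wij[OF ab(1) m]
        wjk[OF ab(2) n] wij[OF prod m'] wjk[OF A.one_even n']])
    show "m \<in> homog M (index_deg i + index_deg j + p)" "n \<in> homog M (index_deg j + index_deg k + q)"
      "m' \<in> homog M (index_deg i + index_deg j + (p + q))"
      "n' \<in> homog M (index_deg j + index_deg k + 0)"
      using m n m' n' by (simp_all only: is_lift_def)
    show "index_deg i + index_deg j + p + (index_deg j + index_deg k + q) =
        index_deg i + index_deg j + (p + q) + (index_deg j + index_deg k + 0)"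
      by (simp only: middle_degree_cancels) (simp only: add_0_right)
    show "(weight t i j \<oplus> weight t j k) \<otimes> (weight t i j \<oplus> weight t j k) = \<one>"
      using t by (auto simp: weight_def L.R.l_minus L.R.r_minus)
    show "\<tau> m \<otimes>\<^bsub>L\<^esub> \<tau> n = \<tau> m' \<otimes>\<^bsub>L\<^esub> \<tau> n'"
      using m n m' n' F_prod[OF ijk ab] F_factor(1)[OF ijk prod] by (simp add: is_lift_def)
  qed simp_all
qed

definition lift :: "nat \<Rightarrow> nat \<Rightarrow> bit \<Rightarrow> 'a \<Rightarrow> 'b" where
  "lift i j p a = (SOME m. is_lift i j p a m)"

text \<open>
  The third index is written \<open>6 - i - j\<close>, because the three indices have the sum 6.
\<close>

definition lifted_F :: "nat \<Rightarrow> nat \<Rightarrow> bit \<Rightarrow> 'a \<Rightarrow> 'b" where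
  "lifted_F i j p a = lift i (6 - i - j) p a \<otimes>\<^bsub>M\<^esub> lift (6 - i - j) j 0 \<one>\<^bsub>A\<^esub>"

lemma is_lift_lift:
  "\<lbrakk>i \<in> {1..3}; j \<in> {1..3}; i \<noteq> j; a \<in> homog A p\<rbrakk> \<Longrightarrow> is_lift i j p a (lift i j p a)"
  unfolding lift_def by (rule someI_ex[OF is_lift_exists])

lemma lifted_F_eq:
  assumes ikj: "i \<in> {1..3}" "k \<in> {1..3}" "j \<in> {1..3}" "distinct [i, k, j]" and a: "a \<in> homog A p"
    and m: "is_lift i k p a m" and n: "is_lift k j 0 \<one>\<^bsub>A\<^esub> n"
  shows "lifted_F i j p a = m \<otimes>\<^bsub>M\<^esub> n"
proof -
  have "6 - i - j = k" using ikj by auto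
  moreover have "is_lift i k p a (lift i k p a)" "is_lift k j 0 \<one>\<^bsub>A\<^esub> (lift k j 0 \<one>\<^bsub>A\<^esub>)"
    using ikj a A.one_even by (auto intro!: is_lift_lift)
  ultimately show ?thesis
    using prod_lifts[of "lift i k p a" "index_deg i + index_deg k + p" m
        "lift k j 0 \<one>\<^bsub>A\<^esub>" "index_deg k + index_deg j + 0" n] m n
    by (simp only: lifted_F_def is_lift_def)
qed

lemma is_lift_lifted_F:
  assumes ij: "i \<in> {1..3}" "j \<in> {1..3}" "i \<noteq> j" and a: "a \<in> homog A p"
  shows "is_lift i j p a (lifted_F i j p a)"
proof -
  define k where "k = 6 - i - j"
  have k: "k \<in> {1..3}" "distinct [i, k, j]" "i \<noteq> k" "k \<noteq> j"
    unfolding k_def by (rule third_index[OF ij(1-3)])+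
  have l: "is_lift i k p a (lift i k p a)" "is_lift k j 0 \<one>\<^bsub>A\<^esub> (lift k j 0 \<one>\<^bsub>A\<^esub>)"
    using ij k a A.one_even by (auto intro!: is_lift_lift)
  have "lifted_F i j p a \<in> homog M (index_deg i + index_deg k + p + (index_deg k + index_deg j + 0))"
    using l unfolding lifted_F_def k_def[symmetric] is_lift_def by (intro M.prod_even) blast+
  then have "lifted_F i j p a \<in> homog M (index_deg i + index_deg j + (p + 0))"
    by (simp only: middle_degree_cancels)
  moreover have "\<tau> (lifted_F i j p a) = F i j p a"
    using l F_factor(1)[OF ij(1) k(1) ij(2) k(2) a] l[THEN is_lift_carrier]
    unfolding lifted_F_def k_def[symmetric] by (simp add: tau_simps is_lift_def)
  ultimately show ?thesis
    by (simp only: is_lift_def add_0_right)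
qed

text \<open>
  Each \<open>lifted_F i j p a\<close> is itself a lift of \<open>F i j p a\<close>.  Hence the bracket relations are statements
  about lifts, and linearity holds because sums and multiples of lifts are lifts.
\<close>

theorem steinberg_family_lifted_F: "steinberg_family K M A lifted_F"
proof
  fix i j :: nat and p a
  assume ij: "i \<in> {1..3}" "j \<in> {1..3}" "i \<noteq> j" and a: "a \<in> homog A p"
  show "lifted_F i j p a \<in> homog M (index_deg i + index_deg j + p)"
    using is_lift_lifted_F[OF ij a] by (simp add: is_lift_def)
next
  fix i j :: nat and p a b
  assume ij: "i \<in> {1..3}" "j \<in> {1..3}" "i \<noteq> j" and a: "a \<in> homog A p" and b: "b \<in> homog A p"
  define k where "k = 6 - i - j"
  have k: "k \<in> {1..3}" "distinct [i, k, j]" "i \<noteq> k" "k \<noteq> j"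
    unfolding k_def by (rule third_index[OF ij(1-3)])+
  have l: "is_lift i k p a (lift i k p a)" "is_lift i k p b (lift i k p b)"
    "is_lift k j 0 \<one>\<^bsub>A\<^esub> (lift k j 0 \<one>\<^bsub>A\<^esub>)"
    using ij k a b A.one_even by (auto intro!: is_lift_lift)
  note carr = l[THEN is_lift_carrier]
  have sum: "is_lift i k p (a \<oplus>\<^bsub>A\<^esub> b) (lift i k p a \<oplus>\<^bsub>M\<^esub> lift i k p b)"
    using l carr F_add[OF ij(1) k(1,3) a b] by (simp add: is_lift_def M.homog_add tau_simps)
  show "lifted_F i j p (a \<oplus>\<^bsub>A\<^esub> b) = lifted_F i j p a \<oplus>\<^bsub>M\<^esub> lifted_F i j p b"
    unfolding lifted_F_eq[OF ij(1) k(1) ij(2) k(2) A.homog_add[OF a b] sum l(3)]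
      lifted_F_eq[OF ij(1) k(1) ij(2) k(2) a l(1,3)] lifted_F_eq[OF ij(1) k(1) ij(2) k(2) b l(2,3)]
    by (rule M.prod_add_left[OF carr])
next
  fix i j :: nat and c p a
  assume ij: "i \<in> {1..3}" "j \<in> {1..3}" "i \<noteq> j" and c: "c \<in> carrier K" and a: "a \<in> homog A p"
  define k where "k = 6 - i - j"
  have k: "k \<in> {1..3}" "distinct [i, k, j]" "i \<noteq> k" "k \<noteq> j"
    unfolding k_def by (rule third_index[OF ij(1-3)])+
  have l: "is_lift i k p a (lift i k p a)" "is_lift k j 0 \<one>\<^bsub>A\<^esub> (lift k j 0 \<one>\<^bsub>A\<^esub>)"
    using ij k a A.one_even by (auto intro!: is_lift_lift)
  note carr = l[THEN is_lift_carrier]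
  have smult: "is_lift i k p (c \<odot>\<^bsub>A\<^esub> a) (c \<odot>\<^bsub>M\<^esub> lift i k p a)"
    using l carr c F_smult[OF ij(1) k(1,3) c a] by (simp add: is_lift_def M.homog_smult tau_simps)
  show "lifted_F i j p (c \<odot>\<^bsub>A\<^esub> a) = c \<odot>\<^bsub>M\<^esub> lifted_F i j p a"
    unfolding lifted_F_eq[OF ij(1) k(1) ij(2) k(2) A.homog_smult[OF c a] smult l(2)]
      lifted_F_eq[OF ij(1) k(1) ij(2) k(2) a l]
    by (rule M.prod_smult_left[OF c carr])
next
  fix i j k :: nat and p a q b
  assume ijk: "i \<in> {1..3}" "j \<in> {1..3}" "k \<in> {1..3}" "distinct [i, j, k]"
    and a: "a \<in> homog A p" and b: "b \<in> homog A q"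
  have ne: "i \<noteq> j" "j \<noteq> k" using ijk by auto
  have ab: "a \<otimes>\<^bsub>A\<^esub> b \<in> homog A (p + q)"
    by (rule A.prod_even[OF a b])
  note l = is_lift_lift[OF ijk(1,2) ne(1) ab] is_lift_lift[OF ijk(2,3) ne(2) A.one_even]
  show "lifted_F i j p a \<otimes>\<^bsub>M\<^esub> lifted_F j k q b = lifted_F i k (p + q) (a \<otimes>\<^bsub>A\<^esub> b)"
    unfolding lifted_F_eq[OF ijk ab l]
    by (rule lifts_prod_move[OF ijk a b is_lift_lifted_F[OF ijk(1,2) ne(1) a]
          is_lift_lifted_F[OF ijk(2,3) ne(2) b] l])
next
  fix i j k l :: nat and p a q b
  assume ij: "i \<in> {1..3}" "j \<in> {1..3}" and kl: "k \<in> {1..3}" "l \<in> {1..3}"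
    and ne: "i \<noteq> j" "k \<noteq> l" "j \<noteq> k" "i \<noteq> l" and a: "a \<in> homog A p" and b: "b \<in> homog A q"
  show "lifted_F i j p a \<otimes>\<^bsub>M\<^esub> lifted_F k l q b = \<zero>\<^bsub>M\<^esub>"
    by (rule lifts_prod_zero[OF ij ne(1) a kl ne(2) b ne(3,4)
          is_lift_lifted_F[OF ij ne(1) a] is_lift_lifted_F[OF kl ne(2) b]])
qed

lemma tau_lifted_F:
  "\<lbrakk>i \<in> {1..3}; j \<in> {1..3}; i \<noteq> j; a \<in> homog A p\<rbrakk> \<Longrightarrow> \<tau> (lifted_F i j p a) = F i j p a"
  using is_lift_lifted_F by (simp add: is_lift_def)

end

lemma st_gens_iff:
  "(i, j, p, a) \<in> st_gens A \<longleftrightarrow> i \<in> {1..3} \<and> j \<in> {1..3} \<and> i \<noteq> j \<and> a \<in> homog A p"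
  by (simp add: st_gens_def)

lemma lie_presentation_steinberg:
  assumes "assoc_superalgebra K A"
  shows "lie_presentation K (st_gens A) (st_rels K A)"
proof -
  interpret A: assoc_superalgebra K A by fact
  have "s \<in> lterms K (st_gens A) \<and> t \<in> lterms K (st_gens A)" if "(s, t) \<in> st_rels K A" for s t
    using that
    by cases (auto simp: st_gens_iff A.homog_add A.homog_smult simp del: add_bit_eq_xor
        intro!: lterms.intros A.prod_even)
  then show ?thesis
    by unfold_locales auto
qed

theorem theorem4p1:
  fixes K :: "('k, 'r) ring_scheme"
    and A :: "('k, 'a, 'm) superalgebra_scheme"
    and M :: "('k, 'b, 'n) superalgebra_scheme"
    and \<tau> :: "'b \<Rightarrow> ('k, 'a st_gen) lterm set"
  assumes "cring K"
    and "assoc_superalgebra K A"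
    and "\<exists>B. free_basis K A B \<and> \<one>\<^bsub>A\<^esub> \<in> B"
    and "central_extension K M (steinberg K A) \<tau>"
  shows "\<exists>!\<eta>. \<eta> \<in> extensional (carrier (steinberg K A)) \<and>
           \<eta> \<in> lie_hom K (steinberg K A) M \<and>
           (\<forall>x\<in>carrier (steinberg K A). \<tau> (\<eta> x) = x)"
proof -
  interpret A: assoc_superalgebra K A by fact
  interpret pres: lie_presentation K "st_gens A" st_deg "st_rels K A"
    by (rule lie_presentation_steinberg[OF assms(2)])
  interpret ext: central_lie_extension K M "steinberg K A" \<tau>
    using assms(4) by (simp add: central_extension_iff_locale)
  have P: "presented_lie K (st_gens A) st_deg (st_rels K A) = steinberg K A"
    by (simp add: steinberg_def)
  define F where "F i j p a = pres.cls (Fgen i j p a)" for i j p a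
  have gen: "Fgen i j p a \<in> lterms K (st_gens A)"
    if "i \<in> {1..3}" "j \<in> {1..3}" "i \<noteq> j" "a \<in> homog A p" for i j p a
    using that by (auto intro: lterms.intros simp: st_gens_iff)
  note ops = pres.add_cls[unfolded P] pres.smult_cls[unfolded P] pres.prod_cls[unfolded P]
    pres.zero_P[unfolded P]
  interpret steinberg_family K "steinberg K A" A F
  proof
    fix i j :: nat and p a
    assume ij: "i \<in> {1..3}" "j \<in> {1..3}" "i \<noteq> j" and a: "a \<in> homog A p"
    have "has_deg K (st_gens A) st_deg (st_deg (i, j, p, a)) (Fgen i j p a)"
      using ij a by (intro has_deg.intros) (simp add: st_gens_iff)
    then show "F i j p a \<in> homog (steinberg K A) (index_deg i + index_deg j + p)"
      unfolding F_def pres.homog_P[unfolded P] by (intro imageI) (simp only: st_deg_def prod.case mem_Collect_eq)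
  next
    fix i j :: nat and p a b
    assume "i \<in> {1..3}" "j \<in> {1..3}" "i \<noteq> j" "a \<in> homog A p" "b \<in> homog A p"
    then show "F i j p (a \<oplus>\<^bsub>A\<^esub> b) = F i j p a \<oplus>\<^bsub>steinberg K A\<^esub> F i j p b"
      unfolding F_def
      by (simp add: ops gen pres.cls_eqI[OF lcong.relation[OF st_rels.F_add]])
  next
    fix i j :: nat and c p a
    assume "i \<in> {1..3}" "j \<in> {1..3}" "i \<noteq> j" "c \<in> carrier K" "a \<in> homog A p"
    then show "F i j p (c \<odot>\<^bsub>A\<^esub> a) = c \<odot>\<^bsub>steinberg K A\<^esub> F i j p a"
      unfolding F_def
      by (simp add: ops gen pres.cls_eqI[OF lcong.relation[OF st_rels.F_smult]])
  next
    fix i j k :: nat and p a q b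
    assume "i \<in> {1..3}" "j \<in> {1..3}" "k \<in> {1..3}" "distinct [i, j, k]"
      "a \<in> homog A p" "b \<in> homog A q"
    then show "F i j p a \<otimes>\<^bsub>steinberg K A\<^esub> F j k q b = F i k (p + q) (a \<otimes>\<^bsub>A\<^esub> b)"
      unfolding F_def
      using pres.cls_eqI[OF lcong.relation[OF st_rels.F_Br[of i j k a A p b q K]]]
      by (simp add: ops gen del: add_bit_eq_xor)
  next
    fix i j k l :: nat and p a q b
    assume "i \<in> {1..3}" "j \<in> {1..3}" "k \<in> {1..3}" "l \<in> {1..3}" "i \<noteq> j" "k \<noteq> l" "j \<noteq> k" "i \<noteq> l"
      "a \<in> homog A p" "b \<in> homog A q"
    then show "F i j p a \<otimes>\<^bsub>steinberg K A\<^esub> F k l q b = \<zero>\<^bsub>steinberg K A\<^esub>"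
      unfolding F_def
      by (simp add: ops gen pres.cls_eqI[OF lcong.relation[OF st_rels.F_Br_Zero]])
  qed
  interpret steinberg_central_extension K "steinberg K A" A F M \<tau> ..
  interpret lifted: steinberg_family K M A lifted_F
    by (rule steinberg_family_lifted_F)
  (* Existence: the lifted generators define a homomorphism, and its composition with \<tau> fixes
     the generators. *)
  define g where "g = (\<lambda>(i, j, p, a). lifted_F i j p a)"
  have "\<exists>\<eta> \<in> lie_hom K (steinberg K A) M \<inter> extensional (carrier (steinberg K A)).
      \<forall>x\<in>st_gens A. \<eta> (pres.cls (Gen x)) = g x"
  proof (rule pres.presented_lie_hom_exists[unfolded P, OF ext.M.lie_superalgebra_axioms])
    show "g x \<in> homog M (st_deg x)" if "x \<in> st_gens A" for x
      using that lifted.F_homog by (cases x) (simp add: g_def st_deg_def st_gens_iff)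
    show "lterm_value M g s = lterm_value M g t" if "(s, t) \<in> st_rels K A" for s t
      using that
      by cases (simp_all add: g_def lifted.F_add lifted.F_smult lifted.F_prod lifted.F_prod_zero)
  qed
  then obtain \<eta> where \<eta>: "\<eta> \<in> lie_hom K (steinberg K A) M" "\<eta> \<in> extensional (carrier (steinberg K A))"
    and \<eta>_gens: "\<And>x. x \<in> st_gens A \<Longrightarrow> \<eta> (pres.cls (Gen x)) = g x"
    by blast
  have \<eta>_section: "\<tau> (\<eta> y) = y" if "y \<in> carrier (steinberg K A)" for y
  proof (rule pres.presented_lie_hom_unique[unfolded P, OF ext.L.abelian_group_axioms
        lie_hom_compose[OF \<eta>(1) ext.hom] lie_hom_id _ that])
    fix x assume x: "x \<in> st_gens A"
    show "\<tau> (\<eta> (pres.cls (Gen x))) = pres.cls (Gen x)"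
      using x \<eta>_gens[OF x] by (cases x) (simp add: g_def tau_lifted_F st_gens_iff F_def)
  qed
  have \<eta>_unique: "\<theta> = \<eta>"
    if \<theta>: "\<theta> \<in> extensional (carrier (steinberg K A))" "\<theta> \<in> lie_hom K (steinberg K A) M"
      "\<forall>x\<in>carrier (steinberg K A). \<tau> (\<theta> x) = x" for \<theta>
  proof (rule extensionalityI[OF \<theta>(1) \<eta>(2)])
    fix y assume y: "y \<in> carrier (steinberg K A)"
    show "\<theta> y = \<eta> y"
    proof (rule pres.presented_lie_hom_unique[unfolded P, OF ext.M.abelian_group_axioms \<theta>(2) \<eta>(1) _ y])
      fix x assume x: "x \<in> st_gens A"
      obtain i j p a where x_eq: "x = (i, j, p, a)" by (cases x)
      with x have ij: "i \<in> {1..3}" "j \<in> {1..3}" "i \<noteq> j" and a: "a \<in> homog A p"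
        by (simp_all add: st_gens_iff)
      define k where "k = 6 - i - j"
      have k: "k \<in> {1..3}" "distinct [i, k, j]" "i \<noteq> k" "k \<noteq> j"
        unfolding k_def by (rule third_index[OF ij(1-3)])+
      note F = F_carrier[OF ij(1) k(1,3) a] F_carrier[OF k(1) ij(2) k(4) A.one_even]
      (* A section maps generators to lifts of them, so its value at the bracket F i j p a of two
         generators is forced. *)
      have "is_lift i k p a (\<theta> (F i k p a))" "is_lift k j 0 \<one>\<^bsub>A\<^esub> (\<theta> (F k j 0 \<one>\<^bsub>A\<^esub>))"
        using lie_hom_homog[OF \<theta>(2)] F_homog[OF ij(1) k(1,3) a] F_homog[OF k(1) ij(2) k(4) A.one_even]
          \<theta>(3) F unfolding is_lift_def by blast+
      then have "lifted_F i j p a = \<theta> (F i k p a) \<otimes>\<^bsub>M\<^esub> \<theta> (F k j 0 \<one>\<^bsub>A\<^esub>)"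
        by (rule lifted_F_eq[OF ij(1) k(1) ij(2) k(2) a])
      also have "\<dots> = \<theta> (F i j p a)"
        using lie_hom_prod[OF \<theta>(2) F] F_factor(1)[OF ij(1) k(1) ij(2) k(2) a] by simp
      finally show "\<theta> (pres.cls (Gen x)) = \<eta> (pres.cls (Gen x))"
        using \<eta>_gens[OF x] by (simp add: x_eq g_def F_def)
    qed
  qed
  show ?thesis
  proof (rule ex1I[of _ \<eta>])
    show "\<eta> \<in> extensional (carrier (steinberg K A)) \<and> \<eta> \<in> lie_hom K (steinberg K A) M \<and>
        (\<forall>x\<in>carrier (steinberg K A). \<tau> (\<eta> x) = x)"
      using \<eta> \<eta>_section by simp
  qed (elim conjE, rule \<eta>_unique)
qed

end
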